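(* Let $p$ be a prime, $f\geq 1$, $q=p^f$, and let $m\geq 0$ be an integer. Let $r=(r_0,\ldots,r_{f-1})$ be a tuple of integers with $r_i\geq m+mq+q$ for all $0\le i\le f-1$. Then: (i) $V_r^{(m)}/V_r^{(m+1)}$ is decomposable into $(m+1)^f-m^f$ principal series; (ii) $V_r/V_r^{(m+1)}$ is decomposable into $(m+1)^f$ principal series.
   Context: For a tuple $r=(r_0,\ldots,r_{f-1})$ of non-negative integers, $V_r=\bigotimes_{i=0}^{f-1}(\mathrm{Sym}^{r_i}\mathbb{F}_q^2\circ\mathrm{Fr}^i)$ is the $\mathbb{F}_q$-space of multi-homogeneous polynomials over $\mathbb{F}_q$ in $x_0,y_0,\ldots,x_{f-1},y_{f-1}$, of degree $r_i$ in $(x_i,y_i)$, with $\alpha=\begin{pmatrix}a&b\\c&d\end{pmatrix}\in\mathrm{GL}_2(\mathbb{F}_q)$ acting by $\alpha\cdot\prod_iP_i(x_i,y_i)=\prod_iP_i(a^{p^i}x_i+c^{p^i}y_i,\,b^{p^i}x_i+d^{p^i}y_i)$. The twisted Dickson polynomials are $\theta_i=x_iy_{i-1}^p-y_ix_{i-1}^p$ for $i\in\{0,\ldots,f-1\}$, with the convention that the index $-1$ means $f-1$. For a polynomial $g$, $\langle g\rangle\subset V_r$ is the subspace of all polynomials in $V_r$ divisible by $g$, and $\langle g_1,\ldots,g_k\rangle=\langle g_1\rangle+\cdots+\langle g_k\rangle$. For $k\geq 0$, $V_r^{(k)}=\langle\theta_0^{k},\ldots,\theta_{f-1}^{k}\rangle$,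 a subrepresentation of $V_r$ (so $V_r^{(0)}=V_r$). A principal series is a representation of $\mathrm{GL}_2(\mathbb{F}_q)$ over $\mathbb{F}_q$ isomorphic to $\mathrm{ind}_{B(\mathbb{F}_q)}^{\mathrm{GL}_2(\mathbb{F}_q)}\chi$ for some character $\chi:B(\mathbb{F}_q)\to\mathbb{F}_q^\times$, where $B(\mathbb{F}_q)$ is the subgroup of upper triangular matrices. A representation is decomposable into $N$ principal series if it has a filtration by subrepresentations, from $0$ to the whole representation, with exactly $N$ successive sub-quotients, each of which is a principal series. *)

theory Defs
  imports "HOL-Analysis.Determinants" "HOL-Algebra.Module" "HOL-Algebra.AbelCoset"
    "HOL-Library.Poly_Mapping"
    "HOL-Computational_Algebra.Primes" begin

section \<open>Representations of groups on vector spaces\<close>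

text \<open>
  As in \<open>HOL-Algebra\<close>, the fields \<open>mult\<close> and \<open>one\<close> inherited from the module record
  play no role.
\<close>

record ('k, 'g, 'v) rep = "('k, 'v) module" +
  act :: "'g \<Rightarrow> 'v \<Rightarrow> 'v"

locale representation = module K V + field K + G: group G
  for K :: "('k, 'c) ring_scheme" (structure)
    and G :: "('g, 'd) monoid_scheme"
    and V :: "('k, 'g, 'v) rep" (structure) +
  assumes act_closed:
      "g \<in> carrier G \<Longrightarrow> v \<in> carrier V \<Longrightarrow> act V g v \<in> carrier V"
    and act_add:
      "g \<in> carrier G \<Longrightarrow> v \<in> carrier V \<Longrightarrow> w \<in> carrier V \<Longrightarrow>
        act V g (v \<oplus>\<^bsub>V\<^esub> w) = act V g v \<oplus>\<^bsub>V\<^esub> act V g w"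
    and act_smult:
      "g \<in> carrier G \<Longrightarrow> c \<in> carrier K \<Longrightarrow> v \<in> carrier V \<Longrightarrow>
        act V g (c \<odot>\<^bsub>V\<^esub> v) = c \<odot>\<^bsub>V\<^esub> act V g v"
    and act_one:
      "v \<in> carrier V \<Longrightarrow> act V \<one>\<^bsub>G\<^esub> v = v"
    and act_mult:
      "g \<in> carrier G \<Longrightarrow> h \<in> carrier G \<Longrightarrow> v \<in> carrier V \<Longrightarrow>
        act V (g \<otimes>\<^bsub>G\<^esub> h) v = act V g (act V h v)"

definition subrepresentation ::
    "'v set \<Rightarrow> ('k, 'c) ring_scheme \<Rightarrow> ('g, 'd) monoid_scheme \<Rightarrow> ('k, 'g, 'v) rep \<Rightarrow> bool"
  where "subrepresentation U K G V \<longleftrightarrow>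
    submodule U K V \<and> (\<forall>g\<in>carrier G. \<forall>u\<in>U. act V g u \<in> U)"

abbreviation sub_rep :: "('k, 'g, 'v) rep \<Rightarrow> 'v set \<Rightarrow> ('k, 'g, 'v) rep"
  where "sub_rep V U \<equiv> V\<lparr>carrier := U\<rparr>"

text \<open>
  The elements of the quotient \<open>V / U\<close> are the cosets of \<open>U\<close>.  For a subrepresentation \<open>U\<close>
  the unions below are unions of copies of a single coset: \<open>c (x + U) = c x + U\<close> and
  \<open>g (x + U) = g x + U\<close>.
\<close>

definition quot_rep :: "('k, 'g, 'v) rep \<Rightarrow> 'v set \<Rightarrow> ('k, 'g, 'v set) rep"
  where "quot_rep V U =
    \<lparr> carrier = a_rcosets\<^bsub>V\<^esub> U,
      mult = undefined,
      one = undefined,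
      zero = U,
      add = (\<lambda>C D. C <+>\<^bsub>V\<^esub> D),
      smult = (\<lambda>c C. \<Union>x\<in>C. U +>\<^bsub>V\<^esub> (c \<odot>\<^bsub>V\<^esub> x)),
      act = (\<lambda>g C. \<Union>x\<in>C. U +>\<^bsub>V\<^esub> act V g x) \<rparr>"

definition rep_isomorphic ::
    "('k, 'c) ring_scheme \<Rightarrow> ('g, 'd) monoid_scheme \<Rightarrow>
      ('k, 'g, 'v) rep \<Rightarrow> ('k, 'g, 'w) rep \<Rightarrow> bool"
  where "rep_isomorphic K G V W \<longleftrightarrow>
    (\<exists>\<phi>. bij_betw \<phi> (carrier V) (carrier W) \<and>
      (\<forall>v\<in>carrier V. \<forall>w\<in>carrier V. \<phi> (v \<oplus>\<^bsub>V\<^esub> w) = \<phi> v \<oplus>\<^bsub>W\<^esub> \<phi> w) \<and>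
      (\<forall>c\<in>carrier K. \<forall>v\<in>carrier V. \<phi> (c \<odot>\<^bsub>V\<^esub> v) = c \<odot>\<^bsub>W\<^esub> \<phi> v) \<and>
      (\<forall>g\<in>carrier G. \<forall>v\<in>carrier V. \<phi> (act V g v) = act W g (\<phi> v)))"

text \<open>
  The representation induced by a character \<open>\<eta>\<close> of a subgroup \<open>B\<close>: the functions
  \<open>\<phi> : G \<rightarrow> K\<close> with \<open>\<phi> (b g) = \<eta> b * \<phi> g\<close>, with \<open>G\<close> acting by right translation.
\<close>

definition ind_rep ::
    "('k, 'c) ring_scheme \<Rightarrow> ('g, 'd) monoid_scheme \<Rightarrow> 'g set \<Rightarrow> ('g \<Rightarrow> 'k) \<Rightarrow>
      ('k, 'g, 'g \<Rightarrow> 'k) rep"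
  where "ind_rep K G B \<eta> =
    \<lparr> carrier = {\<phi> \<in> carrier G \<rightarrow>\<^sub>E carrier K.
        \<forall>b\<in>B. \<forall>g\<in>carrier G. \<phi> (b \<otimes>\<^bsub>G\<^esub> g) = \<eta> b \<otimes>\<^bsub>K\<^esub> \<phi> g},
      mult = undefined,
      one = undefined,
      zero = (\<lambda>g\<in>carrier G. \<zero>\<^bsub>K\<^esub>),
      add = (\<lambda>\<phi> \<psi>. \<lambda>g\<in>carrier G. \<phi> g \<oplus>\<^bsub>K\<^esub> \<psi> g),
      smult = (\<lambda>c \<phi>. \<lambda>g\<in>carrier G. c \<otimes>\<^bsub>K\<^esub> \<phi> g),
      act = (\<lambda>h \<phi>. \<lambda>g\<in>carrier G. \<phi> (g \<otimes>\<^bsub>G\<^esub> h)) \<rparr>"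


section \<open>Principal series of \<open>GL\<^sub>2\<close>\<close>

definition fld :: "'a::field ring"
  where "fld = \<lparr>carrier = UNIV, mult = (*), one = 1, zero = 0, add = (+)\<rparr>"

definition GL2 :: "('a::field ^ 2 ^ 2) monoid"
  where "GL2 = \<lparr>carrier = {A. invertible A}, mult = (**), one = mat 1\<rparr>"

definition borel2 :: "('a::field ^ 2 ^ 2) set"
  where "borel2 = {A \<in> carrier GL2. A $ 2 $ 1 = 0}"

definition principal_series :: "('a::field, 'a ^ 2 ^ 2, 'v) rep \<Rightarrow> bool"
  where "principal_series V \<longleftrightarrow>
    representation fld GL2 V \<and>
    (\<exists>\<eta> \<in> hom (GL2\<lparr>carrier := borel2\<rparr>) (units_of fld).
      rep_isomorphic fld GL2 V (ind_rep fld GL2 borel2 \<eta>))"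

definition decomposable_into_principal_series ::
    "nat \<Rightarrow> ('a::field, 'a ^ 2 ^ 2, 'v) rep \<Rightarrow> bool"
  where "decomposable_into_principal_series N V \<longleftrightarrow>
    representation fld GL2 V \<and>
    (\<exists>U :: nat \<Rightarrow> 'v set.
      U 0 = {\<zero>\<^bsub>V\<^esub>} \<and> U N = carrier V \<and>
      (\<forall>i\<le>N. subrepresentation (U i) fld GL2 V) \<and>
      (\<forall>i<N. U i \<subseteq> U (Suc i) \<and>
        principal_series (quot_rep (sub_rep V (U (Suc i))) (U i))))"


section \<open>Multi-homogeneous polynomials and twisted Dickson polynomials\<close>

text \<open>
  Polynomials in the variables \<open>x\<^sub>i\<close>, \<open>y\<^sub>i\<close> (\<open>i \<in> \<nat>\<close>) are finitely supported functions from
  monomials to coefficients, a monomial being a finitely supported function from variables to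
  exponents.
\<close>

datatype var = XV nat | YV nat

type_synonym 'a mpoly = "(var \<Rightarrow>\<^sub>0 nat) \<Rightarrow>\<^sub>0 'a"

definition Const :: "'a::comm_ring_1 \<Rightarrow> 'a mpoly"
  where "Const c = Poly_Mapping.single 0 c"

definition Var :: "var \<Rightarrow> 'a::comm_ring_1 mpoly"
  where "Var v = Poly_Mapping.single (Poly_Mapping.single v 1) 1"

definition poly_subst :: "(var \<Rightarrow> 'a mpoly) \<Rightarrow> 'a mpoly \<Rightarrow> 'a::comm_ring_1 mpoly"
  where "poly_subst \<sigma> P =
    (\<Sum>m\<in>Poly_Mapping.keys P. Const (Poly_Mapping.lookup P m) *
      (\<Prod>v\<in>Poly_Mapping.keys m. \<sigma> v ^ Poly_Mapping.lookup m v))"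

definition multihom :: "nat \<Rightarrow> (nat \<Rightarrow> nat) \<Rightarrow> 'a::comm_ring_1 mpoly set"
  where "multihom f r = {P. \<forall>m\<in>Poly_Mapping.keys P.
    Poly_Mapping.keys m \<subseteq> XV ` {..<f} \<union> YV ` {..<f} \<and>
    (\<forall>i<f. Poly_Mapping.lookup m (XV i) + Poly_Mapping.lookup m (YV i) = r i)}"

definition twisted_subst :: "nat \<Rightarrow> 'a::comm_ring_1 ^ 2 ^ 2 \<Rightarrow> var \<Rightarrow> 'a mpoly"
  where "twisted_subst p A v = (case v of
      XV i \<Rightarrow> Const ((A $ 1 $ 1) ^ p ^ i) * Var (XV i) + Const ((A $ 2 $ 1) ^ p ^ i) * Var (YV i)
    | YV i \<Rightarrow> Const ((A $ 1 $ 2) ^ p ^ i) * Var (XV i) + Const ((A $ 2 $ 2) ^ p ^ i) * Var (YV i))"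

text \<open>
  The parameters are meant to satisfy \<open>CARD('a) = p ^ f\<close>; only \<open>r 0, \<dots>, r (f - 1)\<close> matter.
\<close>

definition V_rep :: "nat \<Rightarrow> nat \<Rightarrow> (nat \<Rightarrow> nat) \<Rightarrow> ('a::field, 'a ^ 2 ^ 2, 'a mpoly) rep"
  where "V_rep p f r =
    \<lparr> carrier = multihom f r,
      mult = undefined,
      one = undefined,
      zero = 0,
      add = (+),
      smult = (\<lambda>c P. Const c * P),
      act = (\<lambda>A. poly_subst (twisted_subst p A)) \<rparr>"

definition dickson :: "nat \<Rightarrow> nat \<Rightarrow> nat \<Rightarrow> 'a::comm_ring_1 mpoly"
  where "dickson p f i = (let j = (if i = 0 then f - 1 else i - 1) in
    Var (XV i) * Var (YV j) ^ p - Var (YV i) * Var (XV j) ^ p)"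

text \<open>
  Divisibility is taken in the ring of polynomials in all \<open>x\<^sub>i\<close>, \<open>y\<^sub>i\<close> with \<open>i \<in> \<nat>\<close>.  A quotient
  of nonzero polynomials in the variables with index below \<open>f\<close> again involves only these
  variables, so for nonzero \<open>g\<close> in these variables this agrees with divisibility in the polynomial
  ring in the \<open>2 f\<close> variables.
\<close>

definition multiples :: "nat \<Rightarrow> (nat \<Rightarrow> nat) \<Rightarrow> 'a::comm_ring_1 mpoly \<Rightarrow> 'a mpoly set"
  where "multiples f r g = {P \<in> multihom f r. g dvd P}"

definition V_filt :: "nat \<Rightarrow> nat \<Rightarrow> (nat \<Rightarrow> nat) \<Rightarrow> nat \<Rightarrow> 'a::comm_ring_1 mpoly set"
  where "V_filt p f r k =
    {\<Sum>i<f. P i |P. \<forall>i<f. P i \<in> multiples f r (dickson p f i ^ k)}"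

end

theory Submission
  imports Defs "HOL-Number_Theory.Residues" "HOL-Computational_Algebra.Polynomial"
begin

text \<open>
  Order the monomials by their degree in the variables \<open>y\<^sub>i\<close>.  As \<open>p > 1\<close>, the leading monomial of
  \<open>\<theta>\<^sub>i = x\<^sub>i y\<^sub>i\<^sub>-\<^sub>1\<^sup>p - y\<^sub>i x\<^sub>i\<^sub>-\<^sub>1\<^sup>p\<close> is \<open>u\<^sub>i = x\<^sub>i y\<^sub>i\<^sub>-\<^sub>1\<^sup>p\<close>, and no variable occurs in two of the
  \<open>u\<^sub>i\<close>.  Every monomial is therefore in a unique way a product \<open>u\<^sup>j n\<close>, where \<open>u\<^sup>j\<close> is the product of
  powers of the \<open>u\<^sub>i\<close> with exponents \<open>j\<^sub>i\<close> and the monomial \<open>n\<close> is \<^emph>\<open>normal\<close>: no \<open>u\<^sub>i\<close> divides it.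
  The linear map \<open>expand\<close> that replaces \<open>u\<^sup>j n\<close>
  by \<open>\<theta>\<^sup>j n\<close> differs from the identity by terms of lower degree in the \<open>y\<^sub>i\<close>, so it is a bijection
  of every \<open>V\<^sub>r\<close> (\<open>expand_inject\<close>, \<open>expand_surj\<close>), and it turns multiplication by \<open>u\<^sub>i\<close> into
  multiplication by \<open>\<theta>\<^sub>i\<close> (\<open>expand_lead_mult\<close>).  Through it, questions about the ideals generated
  by powers of the \<open>\<theta>\<^sub>i\<close> become questions about exponents of monomials: \<open>V\<^sub>r\<^sup>(\<^sup>k\<^sup>)\<close> is the image of
  the span of the monomials \<open>u\<^sup>j n\<close> with some \<open>j\<^sub>i \<ge> k\<close> (\<open>V_filt_eq\<close>).

  More generally, a set \<open>D\<close> of exponent tuples that contains with \<open>j\<close> all smaller tuples gives the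
  subrepresentation \<open>U(D)\<close>, the image of the span of the \<open>u\<^sup>j n\<close> with \<open>j \<notin> D\<close>; so \<open>V\<^sub>r\<^sup>(\<^sup>k\<^sup>)\<close> belongs
  to the box of all \<open>j\<close> with entries below \<open>k\<close>.  Take a larger and a smaller such set and remove
  from the larger one a maximal tuple outside the smaller one, again and again.  This gives a
  filtration with as many steps as there are tuples in the difference: \<open>(m + 1)\<^sup>f - m\<^sup>f\<close> between two boxes,
  and \<open>(m + 1)\<^sup>f\<close> between a box and the empty set.  In the step that removes \<open>j\<close>, multiplication by \<open>\<theta>\<^sup>j\<close>
  identifies the sub-quotient with \<open>V\<^sub>s / V\<^sub>s\<^sup>(\<^sup>1\<^sup>)\<close>, where \<open>s\<close> is \<open>r\<close> minus the degree of \<open>\<theta>\<^sup>j\<close>, up to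
  a power of the determinant by which the group acts on \<open>\<theta>\<^sup>j\<close> (\<open>theta_mult_mem_iff\<close>,
  \<open>theta_filt_cover\<close>, \<open>act_theta\<close>).

  It remains to see that \<open>V\<^sub>s / V\<^sub>s\<^sup>(\<^sup>1\<^sup>)\<close> is a principal series as soon as all \<open>s\<^sub>i \<ge> p\<close>, which the
  lower bound on \<open>r\<close> guarantees.  All \<open>\<theta>\<^sub>i\<close> vanish at the points \<open>x\<^sub>i = x\<close> to the \<open>p\<^sup>i\<close>, \<open>y\<^sub>i = y\<close> to
  the \<open>p\<^sup>i\<close> with \<open>x\<close>, \<open>y\<close> in the finite field; evaluating \<open>Q \<in> V\<^sub>s\<close> at the point given by the
  second row of \<open>g\<close> is a function of \<open>g\<close> in an induced representation.  Modulo \<open>V\<^sub>s\<^sup>(\<^sup>1\<^sup>)\<close>, only normal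
  monomials matter.  These are the product of all \<open>y\<^sub>i\<close> to the \<open>s\<^sub>i\<close>, and the monomials whose
  exponents of \<open>y\<^sub>0, y\<^sub>1, \<dots>\<close> are the \<open>p\<close>-adic digits of a number \<open>n < q\<close>; the latter vanish at \<open>(0, 1)\<close>
  and take the value \<open>t\<^sup>n\<close> at \<open>(1, t)\<close>.  As every function on the field is given by exactly one
  polynomial of degree less than \<open>q\<close>, evaluation is injective (\<open>mem_V_filt_one_iff\<close>) and
  surjective (\<open>exists_with_values\<close>).
\<close>

section \<open>Subrepresentations and quotients\<close>

lemma representation_sub_rep:
  assumes "representation K G V" and U: "subrepresentation U K G V"
  shows "representation K G (sub_rep V U)"
proof -
  interpret representation K G V by fact
  have sm: "submodule U K V" using U by (simp add: subrepresentation_def)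
  interpret S: module K "sub_rep V U"
    by (rule submodule.submodule_is_module[OF sm module_axioms])
  have "U \<subseteq> carrier V" using submoduleE(1)[OF sm] .
  then show ?thesis using U
    by unfold_locales
      (auto simp: subrepresentation_def act_add act_smult act_mult act_one subset_iff)
qed

text \<open>
  All axioms of a representation are equations, closure properties or the existence of negatives, so
  they pass to the image under a map that respects the operations.
\<close>

lemma representation_image:
  assumes "representation K G V"
    and car: "carrier W = h ` carrier V"
    and zero: "\<zero>\<^bsub>W\<^esub> = h \<zero>\<^bsub>V\<^esub>"
    and add: "\<And>x y. x \<in> carrier V \<Longrightarrow> y \<in> carrier V \<Longrightarrow> h x \<oplus>\<^bsub>W\<^esub> h y = h (x \<oplus>\<^bsub>V\<^esub> y)"
    and smult: "\<And>c x. c \<in> carrier K \<Longrightarrow> x \<in> carrier V \<Longrightarrow> c \<odot>\<^bsub>W\<^esub> h x = h (c \<odot>\<^bsub>V\<^esub> x)"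
    and act: "\<And>g x. g \<in> carrier G \<Longrightarrow> x \<in> carrier V \<Longrightarrow> act W g (h x) = h (act V g x)"
  shows "representation K G W"
proof -
  interpret representation K G V by fact
  have "abelian_group W"
  proof (rule abelian_groupI)
    fix x assume "x \<in> carrier W"
    then obtain v where "v \<in> carrier V" "x = h v" using car by auto
    then have "h (\<ominus>\<^bsub>V\<^esub> v) \<in> carrier W" "h (\<ominus>\<^bsub>V\<^esub> v) \<oplus>\<^bsub>W\<^esub> x = \<zero>\<^bsub>W\<^esub>"
      by (auto simp: car add zero l_neg)
    then show "\<exists>y\<in>carrier W. y \<oplus>\<^bsub>W\<^esub> x = \<zero>\<^bsub>W\<^esub>" by blast
  qed (auto simp: car zero add M.a_ac)
  then have "module K W"
    using is_cring
    by (intro moduleI) (auto simp: car add smult smult_l_distr smult_r_distr smult_assoc1)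
  then show ?thesis
    by (intro representation.intro representation_axioms.intro field_axioms G.group_axioms)
      (auto simp: car add smult act act_closed act_add act_smult act_one act_mult)
qed

context representation
begin

context
  fixes U
  assumes sub: "subrepresentation U K G V"
begin

lemma sub_abelian_subgroup: "abelian_subgroup U V"
  using sub a_comm_group M.abelian_group_axioms
  by (intro abelian_subgroupI3 additive_subgroup.intro)
    (auto simp: subrepresentation_def submodule_def)

interpretation U: abelian_subgroup U V by (rule sub_abelian_subgroup)

lemma sub_smult: "c \<in> carrier K \<Longrightarrow> u \<in> U \<Longrightarrow> c \<odot>\<^bsub>V\<^esub> u \<in> U"
  using sub submodule.smult_closed by (auto simp: subrepresentation_def)

lemma sub_act: "g \<in> carrier G \<Longrightarrow> u \<in> U \<Longrightarrow> act V g u \<in> U"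
  using sub by (auto simp: subrepresentation_def)

lemma coset_eq_iff:
  assumes "x \<in> carrier V" "y \<in> carrier V"
  shows "U +>\<^bsub>V\<^esub> x = U +>\<^bsub>V\<^esub> y \<longleftrightarrow> x \<ominus>\<^bsub>V\<^esub> y \<in> U"
proof -
  have "x \<in> U +>\<^bsub>V\<^esub> y \<longleftrightarrow> x \<ominus>\<^bsub>V\<^esub> y \<in> U"
    using assms by (simp add: U.a_rcos_module a_minus_def)
  then show ?thesis
    using U.a_repr_independence'[OF _ assms(2), of x] U.a_rcos_self[OF assms(1)] by auto
qed

lemma mem_coset_iff:
  assumes "y \<in> carrier V"
  shows "x \<in> U +>\<^bsub>V\<^esub> y \<longleftrightarrow> (\<exists>u\<in>U. x = u \<oplus>\<^bsub>V\<^esub> y)"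
  by (auto simp: a_r_coset_def r_coset_def)

lemma quot_rep_carrier: "carrier (quot_rep V U) = (\<lambda>x. U +>\<^bsub>V\<^esub> x) ` carrier V"
  by (auto simp: quot_rep_def A_RCOSETS_def' a_r_coset_def')

lemma quot_rep_zero: "\<zero>\<^bsub>quot_rep V U\<^esub> = U +>\<^bsub>V\<^esub> \<zero>\<^bsub>V\<^esub>"
  using U.a_subset by (simp add: quot_rep_def)

lemma quot_rep_add:
  assumes "x \<in> carrier V" "y \<in> carrier V"
  shows "(U +>\<^bsub>V\<^esub> x) \<oplus>\<^bsub>quot_rep V U\<^esub> (U +>\<^bsub>V\<^esub> y) = U +>\<^bsub>V\<^esub> (x \<oplus>\<^bsub>V\<^esub> y)"
  using assms by (simp add: quot_rep_def U.a_rcos_sum)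

text \<open>
  Both the scalars and the group act on cosets by the union of the cosets of the images; the
  images of the elements of one coset differ by elements of the subrepresentation, so the union
  is a single coset.
\<close>

lemma union_of_cosets:
  assumes h: "\<And>x. x \<in> carrier V \<Longrightarrow> h x \<in> carrier V"
    and h_add: "\<And>x y. x \<in> carrier V \<Longrightarrow> y \<in> carrier V \<Longrightarrow> h (x \<oplus>\<^bsub>V\<^esub> y) = h x \<oplus>\<^bsub>V\<^esub> h y"
    and hU: "\<And>u. u \<in> U \<Longrightarrow> h u \<in> U" and y: "y \<in> carrier V"
  shows "(\<Union>x\<in>U +>\<^bsub>V\<^esub> y. U +>\<^bsub>V\<^esub> h x) = U +>\<^bsub>V\<^esub> h y"
proof -
  have "U +>\<^bsub>V\<^esub> h x = U +>\<^bsub>V\<^esub> h y" if x: "x \<in> U +>\<^bsub>V\<^esub> y" for x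
  proof -
    obtain u where u: "u \<in> U" "x = u \<oplus>\<^bsub>V\<^esub> y" 
      using iffD1[OF mem_coset_iff[OF y] x] by blast
    then have "h x = h u \<oplus>\<^bsub>V\<^esub> h y" using y by (simp add: h_add)
    then have "h x \<in> U +>\<^bsub>V\<^esub> h y" using hU[OF u(1)] h[OF y] by (auto simp: mem_coset_iff)
    then show ?thesis using h[OF y] U.a_repr_independence' by blast
  qed
  moreover have "y \<in> U +>\<^bsub>V\<^esub> y" using y by (rule U.a_rcos_self)
  ultimately show ?thesis by blast
qed

lemma quot_rep_smult:
  assumes "c \<in> carrier K" "y \<in> carrier V"
  shows "c \<odot>\<^bsub>quot_rep V U\<^esub> (U +>\<^bsub>V\<^esub> y) = U +>\<^bsub>V\<^esub> (c \<odot>\<^bsub>V\<^esub> y)"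
  using assms union_of_cosets[of "\<lambda>x. c \<odot>\<^bsub>V\<^esub> x" y]
  by (simp add: quot_rep_def smult_r_distr sub_smult)

lemma quot_rep_act:
  assumes "g \<in> carrier G" "y \<in> carrier V"
  shows "act (quot_rep V U) g (U +>\<^bsub>V\<^esub> y) = U +>\<^bsub>V\<^esub> (act V g y)"
  using assms union_of_cosets[of "act V g" y]
  by (simp add: quot_rep_def act_add act_closed sub_act)

lemma representation_quot_rep: "representation K G (quot_rep V U)"
  using representation_axioms
  by (rule representation_image)
    (auto simp: quot_rep_carrier quot_rep_zero quot_rep_add quot_rep_smult quot_rep_act)

end

lemma subrepresentationI:
  assumes "U \<subseteq> carrier V" "\<zero>\<^bsub>V\<^esub> \<in> U"
    and add: "\<And>x y. x \<in> U \<Longrightarrow> y \<in> U \<Longrightarrow> x \<oplus>\<^bsub>V\<^esub> y \<in> U"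
    and smult: "\<And>c x. c \<in> carrier K \<Longrightarrow> x \<in> U \<Longrightarrow> c \<odot>\<^bsub>V\<^esub> x \<in> U"
    and act: "\<And>g x. g \<in> carrier G \<Longrightarrow> x \<in> U \<Longrightarrow> act V g x \<in> U"
  shows "subrepresentation U K G V"
proof -
  have "\<ominus>\<^bsub>V\<^esub> x \<in> U" if "x \<in> U" for x
  proof -
    have "\<ominus>\<^bsub>K\<^esub> \<one>\<^bsub>K\<^esub> \<odot>\<^bsub>V\<^esub> x \<in> U" using that by (intro smult) auto
    then show ?thesis using that assms(1) by (auto simp: smult_l_minus subset_iff)
  qed
  then have "submodule U K V" by (intro submoduleI) (auto simp: assms)
  then show ?thesis by (auto simp: subrepresentation_def act)
qed

lemma subrep_subset: "subrepresentation U K G V \<Longrightarrow> U \<subseteq> carrier V"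
  using submoduleE(1) by (auto simp: subrepresentation_def)

lemma subrep_zero: "subrepresentation U K G V \<Longrightarrow> \<zero>\<^bsub>V\<^esub> \<in> U"
  by (metis additive_subgroup.zero_closed abelian_subgroup_def sub_abelian_subgroup)

lemma subrep_add: "subrepresentation U K G V \<Longrightarrow> x \<in> U \<Longrightarrow> y \<in> U \<Longrightarrow> x \<oplus>\<^bsub>V\<^esub> y \<in> U"
  using submoduleE(5) by (auto simp: subrepresentation_def)

lemma subrep_minus: "subrepresentation U K G V \<Longrightarrow> x \<in> U \<Longrightarrow> y \<in> U \<Longrightarrow> x \<ominus>\<^bsub>V\<^esub> y \<in> U"
  using submoduleE(3) subrep_add by (auto simp: subrepresentation_def a_minus_def)

lemma subrepresentation_sub_rep:
  assumes "subrepresentation U K G V" "subrepresentation U' K G V" "U \<subseteq> U'"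
  shows "subrepresentation U K G (sub_rep V U')"
proof -
  interpret S: representation K G "sub_rep V U'"
    by (rule representation_sub_rep) (use assms representation_axioms in auto)
  show ?thesis
    by (rule S.subrepresentationI)
      (use assms in \<open>auto intro: subrep_zero subrep_add sub_smult sub_act\<close>)
qed

lemma subrepresentation_quot_rep:
  assumes U: "subrepresentation U K G V" and U': "subrepresentation U' K G V"
  shows "subrepresentation ((\<lambda>x. U +>\<^bsub>V\<^esub> x) ` U') K G (quot_rep V U)"
proof -
  interpret Q: representation K G "quot_rep V U" by (rule representation_quot_rep) fact
  note U'' = subsetD[OF subrep_subset[OF U']]
  show ?thesis
    by (rule Q.subrepresentationI)
      (auto simp: quot_rep_carrier[OF U] quot_rep_zero[OF U] quot_rep_add[OF U]
        quot_rep_smult[OF U] quot_rep_act[OF U] U''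
        intro!: imageI subrep_zero[OF U'] subrep_add[OF U'] sub_smult[OF U'] sub_act[OF U'])
qed

end


section \<open>Filtrations with principal series as sub-quotients\<close>

text \<open>
  An isomorphism is conveniently given by a set that covers both representations, with the same
  fibres: no map between the two representations has to be written down.
\<close>

lemma rep_isomorphic_common_cover:
  assumes a: "a ` X = carrier V" and b: "b ` X = carrier W"
    and fib: "\<And>x y. x \<in> X \<Longrightarrow> y \<in> X \<Longrightarrow> a x = a y \<longleftrightarrow> b x = b y"
    and add: "\<And>x y. x \<in> X \<Longrightarrow> y \<in> X \<Longrightarrow>
      \<exists>z\<in>X. a z = a x \<oplus>\<^bsub>V\<^esub> a y \<and> b z = b x \<oplus>\<^bsub>W\<^esub> b y"
    and smult: "\<And>c x. c \<in> carrier K \<Longrightarrow> x \<in> X \<Longrightarrow>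
      \<exists>z\<in>X. a z = c \<odot>\<^bsub>V\<^esub> a x \<and> b z = c \<odot>\<^bsub>W\<^esub> b x"
    and act: "\<And>g x. g \<in> carrier G \<Longrightarrow> x \<in> X \<Longrightarrow>
      \<exists>z\<in>X. a z = act V g (a x) \<and> b z = act W g (b x)"
  shows "rep_isomorphic K G V W"
proof -
  define \<phi> where "\<phi> v = b (inv_into X a v)" for v
  have \<phi>: "\<phi> (a x) = b x" if "x \<in> X" for x
    using that fib[of "inv_into X a (a x)" x] by (simp add: \<phi>_def inv_into_into f_inv_into_f)
  have ex: "\<exists>x\<in>X. v = a x" if "v \<in> carrier V" for v
    using that a by auto
  show ?thesis unfolding rep_isomorphic_def
  proof (intro exI[of _ \<phi>] conjI ballI)
    have "inj_on \<phi> (carrier V)"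
      unfolding a[symmetric] by (auto simp: inj_on_def \<phi> fib)
    moreover have "\<phi> ` carrier V = carrier W"
      unfolding a[symmetric] b[symmetric] by (force simp: \<phi>)
    ultimately show "bij_betw \<phi> (carrier V) (carrier W)" by (simp add: bij_betw_def)
  next
    fix v w assume "v \<in> carrier V" "w \<in> carrier V"
    then obtain x y where xy: "x \<in> X" "v = a x" "y \<in> X" "w = a y" using ex by metis
    then obtain z where "z \<in> X" "a z = v \<oplus>\<^bsub>V\<^esub> w" "b z = b x \<oplus>\<^bsub>W\<^esub> b y" using add by metis
    then show "\<phi> (v \<oplus>\<^bsub>V\<^esub> w) = \<phi> v \<oplus>\<^bsub>W\<^esub> \<phi> w" using xy \<phi> by metis
  next
    fix c v assume c: "c \<in> carrier K" "v \<in> carrier V"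
    then obtain x where x: "x \<in> X" "v = a x" using ex by metis
    then obtain z where "z \<in> X" "a z = c \<odot>\<^bsub>V\<^esub> v" "b z = c \<odot>\<^bsub>W\<^esub> b x" using smult c by metis
    then show "\<phi> (c \<odot>\<^bsub>V\<^esub> v) = c \<odot>\<^bsub>W\<^esub> \<phi> v" using x \<phi> by metis
  next
    fix g v assume g: "g \<in> carrier G" "v \<in> carrier V"
    then obtain x where x: "x \<in> X" "v = a x" using ex by metis
    then obtain z where "z \<in> X" "a z = act V g v" "b z = act W g (b x)" using act g by metis
    then show "\<phi> (act V g v) = act W g (\<phi> v)" using x \<phi> by metis
  qed
qed

text \<open>
  The sub-quotient of a filtration of a quotient is a quotient of quotients; this is the third
  isomorphism theorem, in the form of a common cover of \<open>U\<^sub>2 / U\<^sub>1\<close> and \<open>W\<close>.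
\<close>

lemma (in representation) rep_isomorphic_subquotient:
  assumes U0: "subrepresentation U\<^sub>0 K G V" and U1: "subrepresentation U\<^sub>1 K G V"
    and U2: "subrepresentation U\<^sub>2 K G V" and "U\<^sub>0 \<subseteq> U\<^sub>1" "U\<^sub>1 \<subseteq> U\<^sub>2"
    and a: "a ` X \<subseteq> U\<^sub>2" and b: "b ` X = carrier W"
    and cover: "\<And>v. v \<in> U\<^sub>2 \<Longrightarrow> \<exists>x\<in>X. v \<ominus>\<^bsub>V\<^esub> a x \<in> U\<^sub>1"
    and fib: "\<And>x y. x \<in> X \<Longrightarrow> y \<in> X \<Longrightarrow> a x \<ominus>\<^bsub>V\<^esub> a y \<in> U\<^sub>1 \<longleftrightarrow> b x = b y"
    and add: "\<And>x y. x \<in> X \<Longrightarrow> y \<in> X \<Longrightarrow>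
      \<exists>z\<in>X. a z = a x \<oplus>\<^bsub>V\<^esub> a y \<and> b z = b x \<oplus>\<^bsub>W\<^esub> b y"
    and smult: "\<And>c x. c \<in> carrier K \<Longrightarrow> x \<in> X \<Longrightarrow>
      \<exists>z\<in>X. a z = c \<odot>\<^bsub>V\<^esub> a x \<and> b z = c \<odot>\<^bsub>W\<^esub> b x"
    and act: "\<And>g x. g \<in> carrier G \<Longrightarrow> x \<in> X \<Longrightarrow>
      \<exists>z\<in>X. a z = act V g (a x) \<and> b z = act W g (b x)"
  shows "rep_isomorphic K G
    (quot_rep (sub_rep (quot_rep V U\<^sub>0) ((\<lambda>x. U\<^sub>0 +>\<^bsub>V\<^esub> x) ` U\<^sub>2)) ((\<lambda>x. U\<^sub>0 +>\<^bsub>V\<^esub> x) ` U\<^sub>1)) W"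
proof -
  define \<pi> where "\<pi> x = U\<^sub>0 +>\<^bsub>V\<^esub> x" for x
  define Q where "Q = quot_rep V U\<^sub>0"
  define S where "S = sub_rep Q (\<pi> ` U\<^sub>2)"
  note sub2 = subsetD[OF subrep_subset[OF U2]] and sub1 = subsetD[OF subrep_subset[OF U1]]
  have aX: "a x \<in> U\<^sub>2" "a x \<in> carrier V" if "x \<in> X" for x using that a sub2 by auto
  interpret Q: representation K G Q unfolding Q_def by (rule representation_quot_rep) fact
  have sQ: "subrepresentation (\<pi> ` U\<^sub>1) K G Q" "subrepresentation (\<pi> ` U\<^sub>2) K G Q"
    unfolding Q_def \<pi>_def using U0 U1 U2 by (auto intro: subrepresentation_quot_rep)
  interpret S: representation K G S
    unfolding S_def by (rule representation_sub_rep[OF Q.representation_axioms sQ(2)])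
  have sS: "subrepresentation (\<pi> ` U\<^sub>1) K G S"
    unfolding S_def by (rule Q.subrepresentation_sub_rep) (use sQ \<open>U\<^sub>1 \<subseteq> U\<^sub>2\<close> in auto)
  have [simp]: "carrier S = \<pi> ` U\<^sub>2" "add S = add Q" "module.smult S = module.smult Q" "act S = act Q"
    by (simp_all add: S_def)
  have \<pi>mem: "\<pi> v \<in> \<pi> ` U\<^sub>1 \<longleftrightarrow> v \<in> U\<^sub>1" if v: "v \<in> carrier V" for v
  proof
    assume "\<pi> v \<in> \<pi> ` U\<^sub>1"
    then obtain u where u: "u \<in> U\<^sub>1" "\<pi> v = \<pi> u" by auto
    then have "v \<ominus>\<^bsub>V\<^esub> u \<in> U\<^sub>1"
      using coset_eq_iff[OF U0 v sub1[OF u(1)]] \<open>U\<^sub>0 \<subseteq> U\<^sub>1\<close> by (auto simp: \<pi>_def)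
    then have "v \<ominus>\<^bsub>V\<^esub> u \<oplus>\<^bsub>V\<^esub> u \<in> U\<^sub>1" by (intro subrep_add[OF U1] u)
    then show "v \<in> U\<^sub>1" using v sub1[OF u(1)] by (simp add: a_minus_def M.a_assoc M.l_neg)
  qed auto
  have minus: "\<pi> v \<ominus>\<^bsub>S\<^esub> \<pi> w = \<pi> (v \<ominus>\<^bsub>V\<^esub> w)" if "v \<in> U\<^sub>2" "w \<in> U\<^sub>2" for v w
  proof -
    have neg: "\<pi> (\<ominus>\<^bsub>V\<^esub> w) \<in> carrier S"
      using that U2 by (auto simp: subrepresentation_def dest: submoduleE(3))
    have "\<pi> (\<ominus>\<^bsub>V\<^esub> w) \<oplus>\<^bsub>S\<^esub> \<pi> w = \<zero>\<^bsub>S\<^esub>"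
      using that sub2 by (simp add: S_def Q_def \<pi>_def quot_rep_add[OF U0] quot_rep_zero[OF U0] M.l_neg)
    then have "\<ominus>\<^bsub>S\<^esub> \<pi> w = \<pi> (\<ominus>\<^bsub>V\<^esub> w)"
      using that neg by (intro S.minus_equality) auto
    then show ?thesis using that sub2
      by (simp add: a_minus_def) (simp add: Q_def \<pi>_def quot_rep_add[OF U0])
  qed
  define A where "A x = (\<pi> ` U\<^sub>1) +>\<^bsub>S\<^esub> \<pi> (a x)" for x
  have eq: "(\<pi> ` U\<^sub>1) +>\<^bsub>S\<^esub> \<pi> v = (\<pi> ` U\<^sub>1) +>\<^bsub>S\<^esub> \<pi> w \<longleftrightarrow> v \<ominus>\<^bsub>V\<^esub> w \<in> U\<^sub>1"
    if "v \<in> U\<^sub>2" "w \<in> U\<^sub>2" for v w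
    using that sub2 S.coset_eq_iff[OF sS, of "\<pi> v" "\<pi> w"] \<pi>mem[of "v \<ominus>\<^bsub>V\<^esub> w"]
    by (simp add: minus)
  have "rep_isomorphic K G (quot_rep S (\<pi> ` U\<^sub>1)) W"
  proof (rule rep_isomorphic_common_cover[where a = A and b = b and X = X])
    show "A ` X = carrier (quot_rep S (\<pi> ` U\<^sub>1))"
    proof
      show "A ` X \<subseteq> carrier (quot_rep S (\<pi> ` U\<^sub>1))"
        using aX by (auto simp: A_def S.quot_rep_carrier[OF sS])
      show "carrier (quot_rep S (\<pi> ` U\<^sub>1)) \<subseteq> A ` X"
      proof
        fix C assume "C \<in> carrier (quot_rep S (\<pi> ` U\<^sub>1))"
        then obtain v where v: "v \<in> U\<^sub>2" "C = (\<pi> ` U\<^sub>1) +>\<^bsub>S\<^esub> \<pi> v"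
          by (auto simp: S.quot_rep_carrier[OF sS])
        then obtain x where "x \<in> X" "v \<ominus>\<^bsub>V\<^esub> a x \<in> U\<^sub>1" using cover by auto
        then show "C \<in> A ` X" using v eq[OF v(1) aX(1)] by (auto simp: A_def)
      qed
    qed
  next
    fix x y assume xy: "x \<in> X" "y \<in> X"
    show "A x = A y \<longleftrightarrow> b x = b y" using fib[OF xy] eq[OF aX(1)[OF xy(1)] aX(1)[OF xy(2)]]
      by (simp add: A_def)
    obtain z where z: "z\<in>X" "a z = a x \<oplus>\<^bsub>V\<^esub> a y" "b z = b x \<oplus>\<^bsub>W\<^esub> b y" using add xy by blast
    have "A z = A x \<oplus>\<^bsub>quot_rep S (\<pi> ` U\<^sub>1)\<^esub> A y"
      using aX xy by (simp add: A_def S.quot_rep_add[OF sS])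
        (simp add: Q_def z \<pi>_def quot_rep_add[OF U0])
    then show "\<exists>z\<in>X. A z = A x \<oplus>\<^bsub>quot_rep S (\<pi> ` U\<^sub>1)\<^esub> A y \<and> b z = b x \<oplus>\<^bsub>W\<^esub> b y"
      using z by blast
  next
    fix c x assume cx: "c \<in> carrier K" "x \<in> X"
    obtain z where z: "z\<in>X" "a z = c \<odot>\<^bsub>V\<^esub> a x" "b z = c \<odot>\<^bsub>W\<^esub> b x" using smult cx by blast
    have "A z = c \<odot>\<^bsub>quot_rep S (\<pi> ` U\<^sub>1)\<^esub> A x"
      using aX cx by (simp add: A_def S.quot_rep_smult[OF sS])
        (simp add: Q_def z \<pi>_def quot_rep_smult[OF U0])
    then show "\<exists>z\<in>X. A z = c \<odot>\<^bsub>quot_rep S (\<pi> ` U\<^sub>1)\<^esub> A x \<and> b z = c \<odot>\<^bsub>W\<^esub> b x"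
      using z by blast
  next
    fix g x assume gx: "g \<in> carrier G" "x \<in> X"
    obtain z where z: "z\<in>X" "a z = act V g (a x)" "b z = act W g (b x)" using act gx by blast
    have "A z = act (quot_rep S (\<pi> ` U\<^sub>1)) g (A x)"
      using aX gx by (simp add: A_def S.quot_rep_act[OF sS])
        (simp add: Q_def z \<pi>_def quot_rep_act[OF U0])
    then show "\<exists>z\<in>X. A z = act (quot_rep S (\<pi> ` U\<^sub>1)) g (A x) \<and> b z = act W g (b x)"
      using z by blast
  qed (use b in auto)
  then show ?thesis by (simp add: S_def Q_def \<pi>_def)
qed

lemma decomposable_quot_repI:
  fixes U :: "nat \<Rightarrow> 'v set" and W :: "('a::field, 'a ^ 2 ^ 2, 'v) rep"
  assumes "representation fld GL2 W"
    and U: "\<And>i. i \<le> N \<Longrightarrow> subrepresentation (U i) fld GL2 W"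
    and UN: "U N = carrier W"
    and mono: "\<And>i. i < N \<Longrightarrow> U i \<subseteq> U (Suc i)"
    and iso: "\<And>i. i < N \<Longrightarrow> \<exists>\<eta> \<in> hom (GL2\<lparr>carrier := borel2\<rparr>) (units_of fld).
      rep_isomorphic fld GL2
        (quot_rep (sub_rep (quot_rep W (U 0)) ((\<lambda>x. U 0 +>\<^bsub>W\<^esub> x) ` U (Suc i)))
          ((\<lambda>x. U 0 +>\<^bsub>W\<^esub> x) ` U i)) (ind_rep fld GL2 borel2 \<eta>)"
  shows "decomposable_into_principal_series N (quot_rep W (U 0))"
proof -
  interpret representation fld GL2 W by fact
  define Q where "Q = quot_rep W (U 0)"
  define F where "F i = (\<lambda>x. U 0 +>\<^bsub>W\<^esub> x) ` U i" for i
  have U0: "subrepresentation (U 0) fld GL2 W" using U by simp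
  interpret Q: representation fld GL2 Q
    unfolding Q_def by (rule representation_quot_rep[OF U0])
  have sF: "subrepresentation (F i) fld GL2 Q" if "i \<le> N" for i
    unfolding F_def Q_def using U0 U[OF that] by (rule subrepresentation_quot_rep)
  have "F 0 = {\<zero>\<^bsub>Q\<^esub>}"
  proof -
    have "U 0 +>\<^bsub>W\<^esub> x = \<zero>\<^bsub>Q\<^esub>" if "x \<in> U 0" for x
    proof -
      have "x \<in> carrier W" using that subrep_subset[OF U0] by auto
      then show ?thesis
        unfolding Q_def quot_rep_zero[OF U0]
        using subrep_minus[OF U0 that subrep_zero[OF U0]] by (simp add: coset_eq_iff[OF U0])
    qed
    moreover have "U 0 \<noteq> {}" using subrep_zero[OF U0] by auto
    ultimately show ?thesis by (auto simp: F_def)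
  qed
  moreover have "F N = carrier Q" by (simp add: F_def Q_def quot_rep_carrier[OF U0] UN)
  moreover have F_mono: "F i \<subseteq> F (Suc i)" if "i < N" for i
    using mono[OF that] by (auto simp: F_def)
  moreover have "principal_series (quot_rep (sub_rep Q (F (Suc i))) (F i))" if i: "i < N" for i
    unfolding principal_series_def
  proof
    have s: "subrepresentation (F i) fld GL2 (sub_rep Q (F (Suc i)))"
      using i by (intro Q.subrepresentation_sub_rep sF F_mono) auto
    have "representation fld GL2 (sub_rep Q (F (Suc i)))"
      using i by (intro representation_sub_rep[OF Q.representation_axioms sF]) auto
    then show "representation fld GL2 (quot_rep (sub_rep Q (F (Suc i))) (F i))"
      by (rule representation.representation_quot_rep[OF _ s])
  qed (use iso[OF i] in \<open>simp add: F_def Q_def\<close>)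
  ultimately have "decomposable_into_principal_series N Q"
    unfolding decomposable_into_principal_series_def
    using sF Q.representation_axioms by (intro conjI exI[of _ F]) auto
  then show ?thesis by (simp add: Q_def)
qed


section \<open>Evaluating polynomials\<close>

locale unital_ring_hom =
  fixes h :: "'a::comm_ring_1 \<Rightarrow> 'b::comm_ring_1"
  assumes hom_add: "h (x + y) = h x + h y"
    and hom_mult: "h (x * y) = h x * h y"
    and hom_one: "h 1 = 1"
begin

lemma hom_zero: "h 0 = 0"
  using hom_add[of 0 0] by simp

lemma hom_minus: "h (x - y) = h x - h y"
  using hom_add[of "x - y" y] by (simp add: algebra_simps)

lemma hom_sum: "h (sum g A) = (\<Sum>i\<in>A. h (g i))"
  by (induction A rule: infinite_finite_induct) (auto simp: hom_add hom_zero)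

lemma hom_prod: "h (prod g A) = (\<Prod>i\<in>A. h (g i))"
  by (induction A rule: infinite_finite_induct) (auto simp: hom_mult hom_one)

lemma hom_power: "h (x ^ n) = h x ^ n"
  by (induction n) (auto simp: hom_mult hom_one)

end

lemma unital_ring_hom_id: "unital_ring_hom (\<lambda>x. x)"
  by unfold_locales auto

lemma unital_ring_hom_Const: "unital_ring_hom Const"
  by unfold_locales (auto simp: Const_def single_add mult_single)

interpretation Const: unital_ring_hom Const
  by (rule unital_ring_hom_Const)

lemma lookup_Const_mult [simp]:
  "Poly_Mapping.lookup (Const c * P) m = c * Poly_Mapping.lookup P m"
  unfolding Const_def mult_map_scale_conv_mult[symmetric]
  by (simp add: Poly_Mapping.map.rep_eq when_def)

lemma keys_Const_mult: "Poly_Mapping.keys (Const c * P) \<subseteq> Poly_Mapping.keys P"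
  by (auto simp: in_keys_iff)

lemma mpoly_eq_sum_monomials:
  fixes P :: "'a::comm_ring_1 mpoly"
  shows "P = (\<Sum>m\<in>Poly_Mapping.keys P. Poly_Mapping.single m (Poly_Mapping.lookup P m))"
  by (rule poly_mapping_eqI) (auto simp: lookup_sum lookup_single when_def in_keys_iff)

lemma mpoly_induct [case_names zero monomial add]:
  fixes P :: "'a::comm_ring_1 mpoly"
  assumes "R 0" "\<And>m c. R (Poly_Mapping.single m c)" "\<And>P Q. R P \<Longrightarrow> R Q \<Longrightarrow> R (P + Q)"
  shows "R P"
proof -
  have "R (\<Sum>m\<in>A. Poly_Mapping.single m (Poly_Mapping.lookup P m))" if "finite A" for A
    using that by induction (auto simp: assms)
  from this[of "Poly_Mapping.keys P"] show ?thesis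
    by (simp flip: mpoly_eq_sum_monomials)
qed

lemma Const_mult_single: "Const c * Poly_Mapping.single m d = Poly_Mapping.single m (c * d)"
  by (simp add: Const_def mult_single)

text \<open>
  The linear extension of a function on monomials, along \<open>h\<close> on the coefficients.  Evaluation,
  substitution and the expansion in twisted Dickson polynomials are all of this form.
\<close>

definition monom_ext :: "('a::comm_ring_1 \<Rightarrow> 'b::comm_ring_1) \<Rightarrow> ((var \<Rightarrow>\<^sub>0 nat) \<Rightarrow> 'b) \<Rightarrow> 'a mpoly \<Rightarrow> 'b"
  where "monom_ext h B P = (\<Sum>m\<in>Poly_Mapping.keys P. h (Poly_Mapping.lookup P m) * B m)"

context unital_ring_hom
begin

lemma monom_ext_superset:
  assumes "finite A" "Poly_Mapping.keys P \<subseteq> A"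
  shows "monom_ext h B P = (\<Sum>m\<in>A. h (Poly_Mapping.lookup P m) * B m)"
  unfolding monom_ext_def using assms
  by (intro sum.mono_neutral_left) (auto simp: in_keys_iff hom_zero)

lemma monom_ext_add: "monom_ext h B (P + Q) = monom_ext h B P + monom_ext h B Q"
proof -
  let ?A = "Poly_Mapping.keys P \<union> Poly_Mapping.keys Q"
  have "monom_ext h B R = (\<Sum>m\<in>?A. h (Poly_Mapping.lookup R m) * B m)"
    if "R = P + Q \<or> R = P \<or> R = Q" for R
    using that keys_add[of P Q] by (intro monom_ext_superset) auto
  then show ?thesis by (simp add: lookup_add hom_add distrib_right sum.distrib)
qed

lemma monom_ext_zero: "monom_ext h B 0 = 0"
  by (simp add: monom_ext_def)

lemma monom_ext_single: "monom_ext h B (Poly_Mapping.single m c) = h c * B m"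
  by (simp add: monom_ext_def hom_zero)

lemma monom_ext_Const_mult: "monom_ext h B (Const c * P) = h c * monom_ext h B P"
  by (induction P rule: mpoly_induct)
    (auto simp: monom_ext_zero monom_ext_add monom_ext_single Const_mult_single hom_mult
      distrib_left mult.assoc)

lemma monom_ext_minus: "monom_ext h B (P - Q) = monom_ext h B P - monom_ext h B Q"
  using monom_ext_add[of B "P - Q" Q] by (simp add: algebra_simps)

lemma monom_ext_sum: "monom_ext h B (sum P A) = (\<Sum>i\<in>A. monom_ext h B (P i))"
  by (induction A rule: infinite_finite_induct) (auto simp: monom_ext_add monom_ext_zero)

lemma unital_ring_hom_monom_ext:
  assumes "B 0 = 1" and B_add: "\<And>m n. B (m + n) = B m * B n"
  shows "unital_ring_hom (monom_ext h B)"
proof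
  show "monom_ext h B (P + Q) = monom_ext h B P + monom_ext h B Q" for P Q
    by (rule monom_ext_add)
  show "monom_ext h B 1 = 1"
    using monom_ext_single[of B 0 1] by (simp add: assms hom_one)
  show "monom_ext h B (P * Q) = monom_ext h B P * monom_ext h B Q" for P Q
  proof (induction P rule: mpoly_induct)
    case (monomial m c)
    show ?case
      by (induction Q rule: mpoly_induct)
        (simp_all add: monom_ext_zero monom_ext_single mult_single B_add hom_mult distrib_left
          monom_ext_add mult_ac distrib_right)
  qed (auto simp: monom_ext_zero monom_ext_add distrib_right)
qed

end

definition monom_eval :: "(var \<Rightarrow> 'b::comm_ring_1) \<Rightarrow> (var \<Rightarrow>\<^sub>0 nat) \<Rightarrow> 'b"
  where "monom_eval \<sigma> m = (\<Prod>v\<in>Poly_Mapping.keys m. \<sigma> v ^ Poly_Mapping.lookup m v)"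

lemma monom_eval_superset:
  assumes "finite A" "Poly_Mapping.keys m \<subseteq> A"
  shows "monom_eval \<sigma> m = (\<Prod>v\<in>A. \<sigma> v ^ Poly_Mapping.lookup m v)"
  unfolding monom_eval_def using assms
  by (intro prod.mono_neutral_left) (auto simp: in_keys_iff)

lemma monom_eval_zero: "monom_eval \<sigma> 0 = 1"
  by (simp add: monom_eval_def)

lemma monom_eval_single: "monom_eval \<sigma> (Poly_Mapping.single v k) = \<sigma> v ^ k"
  by (simp add: monom_eval_def)

lemma monom_eval_add: "monom_eval \<sigma> (m + n) = monom_eval \<sigma> m * monom_eval \<sigma> n"
proof -
  let ?A = "Poly_Mapping.keys m \<union> Poly_Mapping.keys n"
  have "monom_eval \<sigma> l = (\<Prod>v\<in>?A. \<sigma> v ^ Poly_Mapping.lookup l v)" if "l = m + n \<or> l = m \<or> l = n" for l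
    using that keys_add[of m n] by (intro monom_eval_superset) auto
  then show ?thesis by (simp add: lookup_add power_add prod.distrib)
qed

lemma poly_subst_eq: "poly_subst \<sigma> = monom_ext Const (monom_eval \<sigma>)"
  by (simp add: fun_eq_iff poly_subst_def monom_ext_def monom_eval_def)

definition poly_eval :: "(var \<Rightarrow> 'a::comm_ring_1) \<Rightarrow> 'a mpoly \<Rightarrow> 'a"
  where "poly_eval \<rho> = monom_ext (\<lambda>c. c) (monom_eval \<rho>)"

lemma unital_ring_hom_poly_subst: "unital_ring_hom (poly_subst \<sigma>)"
  unfolding poly_subst_eq
  by (rule Const.unital_ring_hom_monom_ext) (simp_all add: monom_eval_zero monom_eval_add)

lemma unital_ring_hom_poly_eval: "unital_ring_hom (poly_eval \<rho>)"
  unfolding poly_eval_def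
  by (rule unital_ring_hom.unital_ring_hom_monom_ext[OF unital_ring_hom_id])
    (simp_all add: monom_eval_zero monom_eval_add)

interpretation poly_subst: unital_ring_hom "poly_subst \<sigma>" for \<sigma>
  by (rule unital_ring_hom_poly_subst)

interpretation poly_eval: unital_ring_hom "poly_eval \<rho>" for \<rho>
  by (rule unital_ring_hom_poly_eval)

lemma poly_subst_Const: "poly_subst \<sigma> (Const c) = Const c"
  using Const.monom_ext_single[of "monom_eval \<sigma>" 0 c]
  by (simp add: poly_subst_eq Const_def[of c] monom_eval_zero)

lemma poly_subst_Var: "poly_subst \<sigma> (Var v) = \<sigma> v"
  by (simp add: poly_subst_eq Var_def Const.monom_ext_single monom_eval_single Const.hom_one)

lemma poly_eval_single: "poly_eval \<rho> (Poly_Mapping.single m c) = c * monom_eval \<rho> m"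
  by (simp add: poly_eval_def unital_ring_hom.monom_ext_single[OF unital_ring_hom_id])

lemma poly_eval_Const: "poly_eval \<rho> (Const c) = c"
  by (simp add: Const_def poly_eval_single monom_eval_zero)

lemma poly_eval_Var: "poly_eval \<rho> (Var v) = \<rho> v"
  by (simp add: Var_def poly_eval_single monom_eval_single)

lemma hom_poly_subst:
  assumes "unital_ring_hom h"
  shows "h (poly_subst \<sigma> P) = monom_ext (\<lambda>c. h (Const c)) (monom_eval (\<lambda>v. h (\<sigma> v))) P"
proof -
  interpret unital_ring_hom h by fact
  show ?thesis
    by (simp add: poly_subst_def monom_ext_def monom_eval_def hom_sum hom_mult hom_prod hom_power)
qed

lemma poly_subst_poly_subst:
  "poly_subst \<sigma> (poly_subst \<tau> P) = poly_subst (\<lambda>v. poly_subst \<sigma> (\<tau> v)) P"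
  unfolding hom_poly_subst[OF unital_ring_hom_poly_subst] by (simp add: poly_subst_Const) (simp add: poly_subst_eq)

lemma poly_eval_poly_subst:
  "poly_eval \<rho> (poly_subst \<tau> P) = poly_eval (\<lambda>v. poly_eval \<rho> (\<tau> v)) P"
  unfolding hom_poly_subst[OF unital_ring_hom_poly_eval] by (simp add: poly_eval_Const) (simp add: poly_eval_def)

lemma Var_power: "Var v ^ k = Poly_Mapping.single (Poly_Mapping.single v k) 1"
  by (induction k) (simp_all add: Var_def mult_single flip: single_add)

lemma monom_eval_Var: "monom_eval Var m = Poly_Mapping.single m 1"
proof -
  have m: "m = (\<Sum>v\<in>Poly_Mapping.keys m. Poly_Mapping.single v (Poly_Mapping.lookup m v))"
    by (rule poly_mapping_eqI) (auto simp: lookup_sum lookup_single when_def in_keys_iff)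
  have "(\<Prod>v\<in>A. Var v ^ Poly_Mapping.lookup m v) =
      Poly_Mapping.single (\<Sum>v\<in>A. Poly_Mapping.single v (Poly_Mapping.lookup m v)) 1"
    if "finite A" for A
    using that by induction (simp_all add: Var_power mult_single)
  from this[of "Poly_Mapping.keys m"] show ?thesis
    unfolding monom_eval_def m[symmetric] by simp
qed

lemma poly_subst_ident: "(\<And>v. \<sigma> v = Var v) \<Longrightarrow> poly_subst \<sigma> P = P"
proof -
  assume "\<And>v. \<sigma> v = Var v"
  then have "\<sigma> = Var" by auto
  then show ?thesis
    using mpoly_eq_sum_monomials[of P, symmetric]
    by (simp add: poly_subst_eq monom_ext_def monom_eval_Var Const_mult_single)
qed


section \<open>Multi-homogeneous polynomials\<close>

definition has_multidegree :: "nat \<Rightarrow> (nat \<Rightarrow> nat) \<Rightarrow> (var \<Rightarrow>\<^sub>0 nat) \<Rightarrow> bool"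
  where "has_multidegree f r m \<longleftrightarrow>
    Poly_Mapping.keys m \<subseteq> XV ` {..<f} \<union> YV ` {..<f} \<and>
    (\<forall>i<f. Poly_Mapping.lookup m (XV i) + Poly_Mapping.lookup m (YV i) = r i)"

lemma multihom_iff: "P \<in> multihom f r \<longleftrightarrow> (\<forall>m\<in>Poly_Mapping.keys P. has_multidegree f r m)"
  by (simp add: multihom_def has_multidegree_def)

lemma keys_minus_subset:
  fixes P Q :: "'a::comm_ring_1 mpoly"
  shows "Poly_Mapping.keys (P - Q) \<subseteq> Poly_Mapping.keys P \<union> Poly_Mapping.keys Q"
  by (auto simp: in_keys_iff lookup_minus)

lemma keys_add_nat:
  "Poly_Mapping.keys (m + n :: var \<Rightarrow>\<^sub>0 nat) = Poly_Mapping.keys m \<union> Poly_Mapping.keys n"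
  by (auto simp: in_keys_iff lookup_add)

lemma has_multidegree_add:
  assumes "has_multidegree f r m"
  shows "has_multidegree f (\<lambda>k. r k + s k) (m + n) \<longleftrightarrow> has_multidegree f s n"
proof -
  have eq: "Poly_Mapping.lookup (m + n) (XV k) + Poly_Mapping.lookup (m + n) (YV k) = r k + s k \<longleftrightarrow>
      Poly_Mapping.lookup n (XV k) + Poly_Mapping.lookup n (YV k) = s k" if "k < f" for k
    using assms that unfolding has_multidegree_def lookup_add by fastforce
  show ?thesis using assms eq unfolding has_multidegree_def keys_add_nat by blast
qed

lemma has_multidegree_cong:
  "(\<And>k. k < f \<Longrightarrow> r k = s k) \<Longrightarrow> has_multidegree f r m \<longleftrightarrow> has_multidegree f s m"
  by (auto simp: has_multidegree_def)

lemma multihom_cong: "(\<And>k. k < f \<Longrightarrow> r k = s k) \<Longrightarrow> multihom f r = multihom f s"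
  using has_multidegree_cong[of f r s] by (auto simp: multihom_iff)

lemma multihom_zero: "0 \<in> multihom f r"
  by (simp add: multihom_iff)

lemma multihom_add: "P \<in> multihom f r \<Longrightarrow> Q \<in> multihom f r \<Longrightarrow> P + Q \<in> multihom f r"
  using keys_add[of P Q] by (auto simp: multihom_iff)

lemma multihom_sum: "(\<And>i. i \<in> A \<Longrightarrow> P i \<in> multihom f r) \<Longrightarrow> sum P A \<in> multihom f r"
  by (induction A rule: infinite_finite_induct) (auto simp: multihom_add multihom_zero)

lemma multihom_Const_mult: "P \<in> multihom f r \<Longrightarrow> Const c * P \<in> multihom f r"
  using keys_Const_mult[of c P] by (auto simp: multihom_iff)

lemma multihom_minus: "P \<in> multihom f r \<Longrightarrow> Q \<in> multihom f r \<Longrightarrow> P - Q \<in> multihom f r"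
  using keys_minus_subset[of P Q] by (auto simp: multihom_iff)

lemma multihom_single:
  "has_multidegree f r m \<Longrightarrow> Poly_Mapping.single m c \<in> multihom f r"
  by (auto simp: multihom_iff)

lemma multihom_mult:
  assumes "P \<in> multihom f r" "Q \<in> multihom f s"
  shows "P * Q \<in> multihom f (\<lambda>k. r k + s k)"
  unfolding multihom_iff
proof
  fix l assume "l \<in> Poly_Mapping.keys (P * Q)"
  then obtain m n where "l = m + n" "m \<in> Poly_Mapping.keys P" "n \<in> Poly_Mapping.keys Q"
    using keys_mult[of P Q] by blast
  then show "has_multidegree f (\<lambda>k. r k + s k) l"
    using assms has_multidegree_add[of f r m s n] by (simp add: multihom_iff)
qed

lemma multihom_one: "1 \<in> multihom f (\<lambda>_. 0)"
  by (simp add: multihom_iff has_multidegree_def)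

lemma multihom_power: "P \<in> multihom f r \<Longrightarrow> P ^ n \<in> multihom f (\<lambda>k. n * r k)"
proof (induction n)
  case (Suc n)
  then show ?case using multihom_mult[of P f r "P ^ n"] by simp
qed (simp add: multihom_one)

lemma multihom_prod:
  assumes "\<And>i. i \<in> A \<Longrightarrow> P i \<in> multihom f (d i)"
  shows "prod P A \<in> multihom f (\<lambda>k. \<Sum>i\<in>A. d i k)"
  using assms
  by (induction A rule: infinite_finite_induct) (auto simp: multihom_one multihom_mult)

lemma multihom_Var:
  "i < f \<Longrightarrow> Var (XV i) \<in> multihom f (\<lambda>k. of_bool (k = i))"
  "i < f \<Longrightarrow> Var (YV i) \<in> multihom f (\<lambda>k. of_bool (k = i))"
  by (auto simp: multihom_iff Var_def has_multidegree_def lookup_single when_def)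


section \<open>Expansions in the twisted Dickson polynomials\<close>

text \<open>
  The expansion rests on comparing the degree \<open>p\<close> of \<open>x\<^sub>i y\<^sub>i\<^sub>-\<^sub>1\<^sup>p\<close> in the \<open>y\<^sub>i\<close> with the degree 1 of
  \<open>y\<^sub>i x\<^sub>i\<^sub>-\<^sub>1\<^sup>p\<close>, which makes sense over every commutative ring and for every \<open>p > 1\<close>.
\<close>

locale twisted_dickson =
  fixes p f :: nat
  assumes p_gt_1: "1 < p" and f_pos: "0 < f"
begin

definition prv :: "nat \<Rightarrow> nat"
  where "prv i = (if i = 0 then f - 1 else i - 1)"

lemma prv_less: "i < f \<Longrightarrow> prv i < f"
  by (auto simp: prv_def)

lemma prv_inj: "i < f \<Longrightarrow> k < f \<Longrightarrow> prv i = prv k \<longleftrightarrow> i = k"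
  by (auto simp: prv_def)

lemma prv_surj: "k < f \<Longrightarrow> \<exists>i<f. prv i = k"
  using f_pos by (intro exI[of _ "if k = f - 1 then 0 else Suc k"]) (auto simp: prv_def)

lemma dickson_eq: "dickson p f i = Var (XV i) * Var (YV (prv i)) ^ p - Var (YV i) * Var (XV (prv i)) ^ p"
  by (simp add: dickson_def prv_def Let_def)

definition theta :: "(nat \<Rightarrow> nat) \<Rightarrow> 'a::comm_ring_1 mpoly"
  where "theta j = (\<Prod>i<f. dickson p f i ^ j i)"

text \<open>
  The monomial \<open>u\<^sup>j\<close>, the leading monomial of \<open>\<theta>\<^sup>j\<close>.
\<close>

definition lead :: "(nat \<Rightarrow> nat) \<Rightarrow> var \<Rightarrow>\<^sub>0 nat"
  where "lead j = (\<Sum>i<f. Poly_Mapping.single (XV i) (j i) + Poly_Mapping.single (YV (prv i)) (p * j i))"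

text \<open>
  The largest \<open>n\<close> such that the \<open>n\<close>-th power of \<open>u\<^sub>i\<close> divides \<open>m\<close>.
\<close>

definition expn :: "(var \<Rightarrow>\<^sub>0 nat) \<Rightarrow> nat \<Rightarrow> nat"
  where "expn m i = min (Poly_Mapping.lookup m (XV i)) (Poly_Mapping.lookup m (YV (prv i)) div p)"

definition normal_part :: "(var \<Rightarrow>\<^sub>0 nat) \<Rightarrow> var \<Rightarrow>\<^sub>0 nat"
  where "normal_part m = m - lead (expn m)"

lemma lookup_lead_X: "Poly_Mapping.lookup (lead j) (XV k) = (if k < f then j k else 0)"
  by (simp add: lead_def lookup_sum lookup_add lookup_single when_def)

lemma lookup_lead_Y:
  assumes "i < f"
  shows "Poly_Mapping.lookup (lead j) (YV (prv i)) = p * j i"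
proof -
  have "Poly_Mapping.lookup (lead j) (YV (prv i)) = (\<Sum>k<f. if prv k = prv i then p * j k else 0)"
    by (simp add: lead_def lookup_sum lookup_add lookup_single when_def)
  also have "\<dots> = (\<Sum>k<f. if k = i then p * j k else 0)"
    using assms by (intro sum.cong) (auto simp: prv_inj)
  finally show ?thesis using assms by simp
qed

lemma lookup_lead_Y_outside:
  assumes "\<not> k < f"
  shows "Poly_Mapping.lookup (lead j) (YV k) = 0"
proof -
  have "prv i \<noteq> k" if "i < f" for i using prv_less[OF that] assms by auto
  then show ?thesis by (simp add: lead_def lookup_sum lookup_add lookup_single when_def)
qed

text \<open>
  Every \<open>y\<close>-variable with index below \<open>f\<close> is written with the predecessor of an index, because this
  is how it occurs in \<open>u\<^sub>i\<close>.
\<close>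

lemma var_cases:
  obtains (X) i where "i < f" "v = XV i" | (Y) i where "i < f" "v = YV (prv i)"
  | (outside) i where "\<not> i < f" "v = XV i \<or> v = YV i"
  using prv_surj by (cases v) metis+

lemma lead_cong: "(\<And>i. i < f \<Longrightarrow> j i = j' i) \<Longrightarrow> lead j = lead j'"
  by (simp add: lead_def)

lemma lead_add: "lead (\<lambda>i. j i + j' i) = lead j + lead j'"
  by (simp add: lead_def single_add distrib_left sum.distrib add_ac)

lemma theta_cong: "(\<And>i. i < f \<Longrightarrow> j i = j' i) \<Longrightarrow> theta j = theta j'"
  by (simp add: theta_def)

lemma theta_add: "theta (\<lambda>i. j i + j' i) = theta j * theta j'"
  by (simp add: theta_def power_add prod.distrib)

text \<open>
  The subtraction in the definition of the normal part is truncated; it is exact because the \<open>u\<^sub>i\<close>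
  have no variable in common, so that the powers of the single \<open>u\<^sub>i\<close> dividing \<open>m\<close> may be divided out
  independently of each other.
\<close>

lemma normal_part_add: "m = normal_part m + lead (expn m)"
proof (rule poly_mapping_eqI)
  fix v
  have "Poly_Mapping.lookup (lead (expn m)) v \<le> Poly_Mapping.lookup m v"
  proof (cases v rule: var_cases)
    case (X i)
    then show ?thesis by (simp add: lookup_lead_X expn_def)
  next
    case (Y i)
    have "p * expn m i \<le> p * (Poly_Mapping.lookup m (YV (prv i)) div p)"
      unfolding expn_def by (intro mult_left_mono) auto
    also have "\<dots> \<le> Poly_Mapping.lookup m (YV (prv i))" by simp
    finally show ?thesis using Y by (simp add: lookup_lead_Y)
  next
    case (outside i)
    then show ?thesis by (auto simp: lookup_lead_X lookup_lead_Y_outside)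
  qed
  then show "Poly_Mapping.lookup m v = Poly_Mapping.lookup (normal_part m + lead (expn m)) v"
    by (simp add: normal_part_def lookup_add minus_poly_mapping.rep_eq)
qed

lemma expn_lead_add: "i < f \<Longrightarrow> expn (lead j + m) i = j i + expn m i"
  using p_gt_1 by (simp add: expn_def lookup_add lookup_lead_X lookup_lead_Y)

lemma normal_part_lead_add: "normal_part (lead j + m) = normal_part m"
proof -
  have "lead (expn (lead j + m)) = lead (\<lambda>i. j i + expn m i)"
    by (rule lead_cong) (simp add: expn_lead_add)
  then have "lead (expn (lead j + m)) = lead j + lead (expn m)" by (simp add: lead_add)
  then have "lead j + m = normal_part m + lead (expn (lead j + m))"
    by (subst (1) normal_part_add) (simp add: add_ac)
  then show ?thesis unfolding normal_part_def[of "lead j + m"] by (metis add_diff_cancel_right')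
qed

definition theta_monom :: "(var \<Rightarrow>\<^sub>0 nat) \<Rightarrow> 'a::comm_ring_1 mpoly"
  where "theta_monom m = theta (expn m) * Poly_Mapping.single (normal_part m) 1"

lemma theta_monom_lead_add:
  "theta_monom (lead j + m) = theta j * (theta_monom m :: 'a::comm_ring_1 mpoly)"
proof -
  have "theta (expn (lead j + m)) = (theta (\<lambda>i. j i + expn m i) :: 'a mpoly)"
    by (rule theta_cong) (simp add: expn_lead_add)
  then have "theta (expn (lead j + m)) = (theta j * theta (expn m) :: 'a mpoly)"
    by (simp add: theta_add)
  then show ?thesis by (simp add: theta_monom_def normal_part_lead_add mult_ac)
qed

definition expand :: "'a::comm_ring_1 mpoly \<Rightarrow> 'a mpoly"
  where "expand = monom_ext Const theta_monom"

lemma expand_zero: "expand 0 = 0"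
  by (simp add: expand_def Const.monom_ext_zero)

lemma expand_add: "expand (P + Q) = expand P + expand Q"
  by (simp add: expand_def Const.monom_ext_add)

lemma expand_minus: "expand (P - Q) = expand P - expand Q"
  by (simp add: expand_def Const.monom_ext_minus)

lemma expand_sum: "expand (sum P A) = (\<Sum>i\<in>A. expand (P i))"
  by (simp add: expand_def Const.monom_ext_sum)

lemma expand_Const_mult: "expand (Const c * P) = Const c * expand P"
  by (simp add: expand_def Const.monom_ext_Const_mult)

lemma expand_single: "expand (Poly_Mapping.single m c) = Const c * theta_monom m"
  by (simp add: expand_def Const.monom_ext_single)

lemma expand_eq: "expand P = (\<Sum>m\<in>Poly_Mapping.keys P. Const (Poly_Mapping.lookup P m) * theta_monom m)"
  by (simp add: expand_def monom_ext_def)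

text \<open>
  Multiplying a monomial by \<open>u\<^sup>j\<close> adds \<open>j\<close> to its exponents and leaves its normal part alone.
\<close>

lemma expand_lead_mult: "expand (Poly_Mapping.single (lead j) 1 * P) = theta j * expand P"
  by (induction P rule: mpoly_induct)
    (simp_all add: expand_zero expand_add distrib_left mult_single expand_single
      theta_monom_lead_add mult.left_commute)

subsection \<open>Leading monomials with respect to the degree in the \<open>y\<^sub>i\<close>\<close>

definition ydeg :: "(var \<Rightarrow>\<^sub>0 nat) \<Rightarrow> nat"
  where "ydeg m = (\<Sum>i<f. Poly_Mapping.lookup m (YV i))"

definition below :: "nat \<Rightarrow> 'a::comm_ring_1 mpoly set"
  where "below N = {P. \<forall>m\<in>Poly_Mapping.keys P. ydeg m < N}"

lemma ydeg_add: "ydeg (m + n) = ydeg m + ydeg n"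
  by (simp add: ydeg_def lookup_add sum.distrib)

lemma below_zero: "0 \<in> below N"
  by (simp add: below_def)

lemma below_add: "P \<in> below N \<Longrightarrow> Q \<in> below N \<Longrightarrow> P + Q \<in> below N"
  using keys_add[of P Q] by (auto simp: below_def)

lemma below_minus: "P \<in> below N \<Longrightarrow> Q \<in> below N \<Longrightarrow> P - Q \<in> below N"
  using keys_minus_subset[of P Q] by (auto simp: below_def)

lemma below_Const_mult: "P \<in> below N \<Longrightarrow> Const c * P \<in> below N"
  using keys_Const_mult[of c P] by (auto simp: below_def)

lemma below_sum: "(\<And>i. i \<in> A \<Longrightarrow> P i \<in> below N) \<Longrightarrow> sum P A \<in> below N"
  by (induction A rule: infinite_finite_induct) (auto simp: below_add below_zero)

lemma below_mono: "P \<in> below N \<Longrightarrow> N \<le> N' \<Longrightarrow> P \<in> below N'"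
  by (auto simp: below_def)

lemma below_single: "ydeg m < N \<Longrightarrow> Poly_Mapping.single m c \<in> below N"
  by (simp add: below_def)

lemma below_mult:
  assumes "P \<in> below a" "Q \<in> below (Suc b)"
  shows "P * Q \<in> below (a + b)"
  unfolding below_def
proof (intro CollectI ballI)
  fix l assume "l \<in> Poly_Mapping.keys (P * Q)"
  then obtain m n where l: "l = m + n" "m \<in> Poly_Mapping.keys P" "n \<in> Poly_Mapping.keys Q"
    using keys_mult[of P Q] by blast
  then have "ydeg m < a" "ydeg n < Suc b" using assms by (auto simp: below_def)
  then show "ydeg l < a + b" by (simp add: l ydeg_add)
qed

lemma ex_below: "\<exists>N. P \<in> below N"
proof
  show "P \<in> below (Suc (\<Sum>m\<in>Poly_Mapping.keys P. ydeg m))"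
    by (auto simp: below_def less_Suc_eq_le intro: member_le_sum)
qed

text \<open>
  The polynomial \<open>P\<close> is the monomial \<open>m\<close>, with coefficient 1, plus terms of smaller degree in the
  \<open>y\<^sub>i\<close>.  The degree does not order the monomials totally, but leading monomials in
  this sense are multiplicative.
\<close>

definition has_lead :: "'a::comm_ring_1 mpoly \<Rightarrow> (var \<Rightarrow>\<^sub>0 nat) \<Rightarrow> bool"
  where "has_lead P m \<longleftrightarrow> P - Poly_Mapping.single m 1 \<in> below (ydeg m)"

lemma has_lead_single: "has_lead (Poly_Mapping.single m 1) m"
  by (simp add: has_lead_def below_zero)

lemma has_lead_below: "has_lead P m \<Longrightarrow> P \<in> below (Suc (ydeg m))"
  using below_add[of "P - Poly_Mapping.single m 1" "Suc (ydeg m)" "Poly_Mapping.single m 1"]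
    below_mono[of "P - Poly_Mapping.single m 1" "ydeg m" "Suc (ydeg m)"]
  by (simp add: has_lead_def below_single)

lemma has_lead_mult:
  fixes P Q :: "'a::comm_ring_1 mpoly"
  assumes "has_lead P m" "has_lead Q n"
  shows "has_lead (P * Q) (m + n)"
proof -
  let ?m = "Poly_Mapping.single m 1" and ?n = "Poly_Mapping.single n 1"
  have "(P - ?m) * Q \<in> below (ydeg m + ydeg n)"
    using assms has_lead_below by (intro below_mult) (auto simp: has_lead_def)
  moreover have "(Q - ?n) * ?m \<in> below (ydeg n + ydeg m)"
    using assms by (intro below_mult below_single) (auto simp: has_lead_def)
  ultimately have "(P - ?m) * Q + (Q - ?n) * ?m \<in> below (ydeg (m + n))"
    by (intro below_add) (simp_all add: ydeg_add add_ac)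
  moreover have "?m * ?n = Poly_Mapping.single (m + n) (1 :: 'a)" by (simp add: mult_single)
  ultimately show ?thesis
    by (simp add: has_lead_def algebra_simps)
qed

lemma has_lead_one: "has_lead 1 0"
  using has_lead_single[of 0] by simp

lemma has_lead_prod:
  "(\<And>i. i \<in> A \<Longrightarrow> has_lead (P i) (w i)) \<Longrightarrow> has_lead (prod P A) (sum w A)"
  by (induction A rule: infinite_finite_induct) (auto simp: has_lead_one has_lead_mult)

lemma ydeg_single_Y: "k < f \<Longrightarrow> ydeg (Poly_Mapping.single (YV k) n) = n"
  by (simp add: ydeg_def lookup_single when_def)

lemma ydeg_single_X: "ydeg (Poly_Mapping.single (XV k) n) = 0"
  by (simp add: ydeg_def lookup_single when_def)

text \<open>
  Here \<open>p > 1\<close> decides which of the two terms of \<open>\<theta>\<^sub>i\<close> leads.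
\<close>

lemma has_lead_dickson:
  assumes "i < f"
  shows "has_lead (dickson p f i :: 'a::comm_ring_1 mpoly) (Poly_Mapping.single (XV i) 1 + Poly_Mapping.single (YV (prv i)) p)"
proof -
  have "(Var (YV i) * Var (XV (prv i)) ^ p :: 'a mpoly) =
      Poly_Mapping.single (Poly_Mapping.single (YV i) 1 + Poly_Mapping.single (XV (prv i)) p) 1"
    by (simp add: Var_power mult_single) (simp add: Var_def mult_single)
  moreover have "(Var (XV i) * Var (YV (prv i)) ^ p :: 'a mpoly) =
      Poly_Mapping.single (Poly_Mapping.single (XV i) 1 + Poly_Mapping.single (YV (prv i)) p) 1"
    by (simp add: Var_power mult_single) (simp add: Var_def mult_single)
  ultimately show ?thesis using p_gt_1 assms prv_less[OF assms]
    by (simp add: has_lead_def dickson_eq ydeg_add ydeg_single_X ydeg_single_Y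
      below_minus[OF below_zero below_single, simplified])
qed

lemma has_lead_dickson_power:
  assumes "i < f"
  shows "has_lead (dickson p f i ^ n)
    (Poly_Mapping.single (XV i) n + Poly_Mapping.single (YV (prv i)) (p * n))"
proof (induction n)
  case (Suc n)
  show ?case using has_lead_mult[OF has_lead_dickson[OF assms] Suc]
    by (simp add: single_add[of "XV i" 1 n, simplified] single_add[of _ p "p * n"] add_ac)
qed (simp add: has_lead_one)

lemma has_lead_theta: "has_lead (theta j) (lead j)"
  unfolding theta_def lead_def by (rule has_lead_prod) (simp add: has_lead_dickson_power)

lemma has_lead_theta_monom: "has_lead (theta_monom m) m"
  using has_lead_mult[OF has_lead_theta[of "expn m"] has_lead_single[of "normal_part m"]]
    normal_part_add[of m]
  by (simp add: theta_monom_def add.commute)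

text \<open>
  Iterating this shows that the difference of \<open>expand\<close> and the identity is locally nilpotent, so that
  \<open>expand\<close> is injective and surjective.
\<close>

lemma expand_lowers_ydeg:
  fixes P :: "'a::comm_ring_1 mpoly"
  assumes "P \<in> below (Suc N)"
  shows "P - expand P \<in> below N"
proof -
  have "P - expand P = (\<Sum>m\<in>Poly_Mapping.keys P.
      Const (Poly_Mapping.lookup P m) * (Poly_Mapping.single m 1 - theta_monom m))"
    unfolding right_diff_distrib sum_subtractf expand_eq[symmetric]
    using mpoly_eq_sum_monomials[of P] by (simp add: Const_mult_single)
  moreover have "Poly_Mapping.single m 1 - (theta_monom m :: 'a mpoly) \<in> below N"
    if "m \<in> Poly_Mapping.keys P" for m
  proof -
    have "ydeg m \<le> N" using that assms by (auto simp: below_def)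
    moreover have "0 - (theta_monom m - Poly_Mapping.single m 1 :: 'a mpoly) \<in> below (ydeg m)"
      using has_lead_theta_monom[of m] by (intro below_minus[OF below_zero]) (simp add: has_lead_def)
    ultimately show ?thesis using below_mono by simp
  qed
  ultimately show ?thesis by (simp add: below_sum below_Const_mult)
qed

lemma expand_eq_zero_iff: "expand P = 0 \<longleftrightarrow> P = 0"
proof
  assume P: "expand P = 0"
  have "P \<in> below 0" if "P \<in> below N" for N
    using that
  proof (induction N)
    case (Suc N)
    then show ?case using expand_lowers_ydeg[of P N] P by simp
  qed
  then have "P \<in> below 0" using ex_below by blast
  then show "P = 0" by (simp add: below_def)
qed (simp add: expand_zero)

lemma expand_inject: "expand P = expand Q \<longleftrightarrow> P = Q"
  using expand_eq_zero_iff[of "P - Q"] by (simp add: expand_minus)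

subsection \<open>Degrees\<close>

definition theta_degree :: "(nat \<Rightarrow> nat) \<Rightarrow> nat \<Rightarrow> nat"
  where "theta_degree j k = (\<Sum>i<f. j i * (of_bool (k = i) + p * of_bool (k = prv i)))"

lemma multihom_dickson:
  assumes "i < f"
  shows "(dickson p f i :: 'a::comm_ring_1 mpoly) \<in> multihom f (\<lambda>k. of_bool (k = i) + p * of_bool (k = prv i))"
proof -
  have "(Var (XV i) * Var (YV (prv i)) ^ p :: 'a mpoly) \<in> multihom f (\<lambda>k. of_bool (k = i) + p * of_bool (k = prv i))"
    using assms prv_less by (intro multihom_mult multihom_power multihom_Var) auto
  moreover have "(Var (YV i) * Var (XV (prv i)) ^ p :: 'a mpoly) \<in> multihom f (\<lambda>k. of_bool (k = i) + p * of_bool (k = prv i))"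
    using assms prv_less by (intro multihom_mult multihom_power multihom_Var) auto
  ultimately show ?thesis by (simp add: dickson_eq multihom_minus)
qed

lemma multihom_theta: "theta j \<in> multihom f (theta_degree j)"
  unfolding theta_def theta_degree_def
  by (intro multihom_prod multihom_power multihom_dickson) simp

lemma has_multidegree_lead: "has_multidegree f (theta_degree j) (lead j)"
  unfolding has_multidegree_def
proof (intro conjI allI impI)
  show "Poly_Mapping.keys (lead j) \<subseteq> XV ` {..<f} \<union> YV ` {..<f}"
  proof
    fix v assume "v \<in> Poly_Mapping.keys (lead j)"
    then show "v \<in> XV ` {..<f} \<union> YV ` {..<f}"
      using prv_less by (cases v rule: var_cases)
        (auto simp: in_keys_iff lookup_lead_X lookup_lead_Y_outside)
  qed
  fix k assume "k < f"
  then obtain i where i: "i < f" "prv i = k" using prv_surj by blast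
  have "theta_degree j k = (\<Sum>i'<f. if i' = k then j i' else 0) + (\<Sum>i'<f. if i' = i then p * j i' else 0)"
    unfolding theta_degree_def sum.distrib[symmetric]
    by (rule sum.cong) (use i prv_inj[OF i(1)] in auto)
  then show "Poly_Mapping.lookup (lead j) (XV k) + Poly_Mapping.lookup (lead j) (YV k) = theta_degree j k"
    using \<open>k < f\<close> i(1) by (simp add: lookup_lead_X lookup_lead_Y[OF i(1), unfolded i(2)])
qed

text \<open>
  The variables with index \<open>k\<close> occur in \<open>\<theta>\<^sub>k\<close>, with degree 1, and in \<open>\<theta>\<^sub>k\<^sub>+\<^sub>1\<close>, with degree \<open>p\<close>.
\<close>

lemma theta_degree_le:
  assumes "k < f" "\<And>i. i < f \<Longrightarrow> j i \<le> m"
  shows "theta_degree j k \<le> m + p * m"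
proof -
  obtain i where i: "i < f" "prv i = k" using prv_surj assms by blast
  have "theta_degree j k = j k + p * j i"
    using has_multidegree_lead[of j] assms lookup_lead_Y[OF i(1), of j]
    by (auto simp: has_multidegree_def lookup_lead_X i)
  also have "\<dots> \<le> m + p * m" using assms i by (intro add_mono mult_left_mono) auto
  finally show ?thesis .
qed

lemma has_multidegree_lead_add:
  assumes "\<And>k. k < f \<Longrightarrow> r k = theta_degree j k + s k"
  shows "has_multidegree f r (lead j + m) \<longleftrightarrow> has_multidegree f s m"
  using has_multidegree_add[OF has_multidegree_lead, of j s m] has_multidegree_cong[of f r] assms
  by simp

lemma theta_mult_multihom:
  fixes Q :: "'a::comm_ring_1 mpoly"
  assumes "\<And>k. k < f \<Longrightarrow> r k = theta_degree j k + s k" "Q \<in> multihom f s"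
  shows "theta j * Q \<in> multihom f r"
  using multihom_mult[OF multihom_theta assms(2), of j]
    multihom_cong[of f r "\<lambda>k. theta_degree j k + s k", where ?'a = 'a] assms(1) by simp

lemma normal_part_multidegree:
  assumes "has_multidegree f r m"
  obtains s where "\<And>k. k < f \<Longrightarrow> r k = theta_degree (expn m) k + s k"
    "has_multidegree f s (normal_part m)"
proof
  let ?s = "\<lambda>k. Poly_Mapping.lookup (normal_part m) (XV k) + Poly_Mapping.lookup (normal_part m) (YV k)"
  have m: "m = lead (expn m) + normal_part m" using normal_part_add by (simp add: add.commute)
  show s: "r k = theta_degree (expn m) k + ?s k" if "k < f" for k
  proof -
    have "Poly_Mapping.lookup m (XV k) + Poly_Mapping.lookup m (YV k) = r k"
      using assms that by (simp add: has_multidegree_def)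
    moreover have "Poly_Mapping.lookup (lead (expn m)) (XV k) +
        Poly_Mapping.lookup (lead (expn m)) (YV k) = theta_degree (expn m) k"
      using has_multidegree_lead that by (simp add: has_multidegree_def)
    ultimately show ?thesis by (subst (asm) (1 2) m) (simp add: lookup_add)
  qed
  show "has_multidegree f ?s (normal_part m)"
    using assms has_multidegree_lead_add[of r "expn m" ?s "normal_part m"] s
    by (simp flip: m)
qed

lemma multihom_theta_monom:
  assumes "has_multidegree f r m"
  shows "theta_monom m \<in> multihom f r"
  using assms
proof (rule normal_part_multidegree)
  fix s assume "\<And>k. k < f \<Longrightarrow> r k = theta_degree (expn m) k + s k"
    "has_multidegree f s (normal_part m)"
  then show ?thesis unfolding theta_monom_def
    by (intro theta_mult_multihom multihom_single)
qed

lemma multihom_expand: "P \<in> multihom f r \<Longrightarrow> expand P \<in> multihom f r"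
  unfolding expand_eq
  by (intro multihom_sum multihom_Const_mult multihom_theta_monom) (simp add: multihom_iff)

text \<open>
  The preimage is built from \<open>P\<close> by sums and by \<open>expand\<close> itself, both of which keep every
  multidegree; so one preimage serves all \<open>r\<close> at once.
\<close>

lemma expand_surj: "\<exists>Q. expand Q = P \<and> (\<forall>r. P \<in> multihom f r \<longrightarrow> Q \<in> multihom f r)"
proof -
  have "\<exists>Q. expand Q = P \<and> (\<forall>r. P \<in> multihom f r \<longrightarrow> Q \<in> multihom f r)" if "P \<in> below N" for N
    using that
  proof (induction N arbitrary: P)
    case 0
    then have "P = 0" by (simp add: below_def)
    then show ?case by (intro exI[of _ 0]) (simp add: expand_zero)
  next
    case (Suc N)
    then obtain Q where Q: "expand Q = P - expand P"
      "\<And>r. P - expand P \<in> multihom f r \<Longrightarrow> Q \<in> multihom f r"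
      using expand_lowers_ydeg by metis
    show ?case
    proof (intro exI conjI allI impI)
      show "expand (P + Q) = P" by (simp add: expand_add Q)
      show "P + Q \<in> multihom f r" if "P \<in> multihom f r" for r
        using that by (intro multihom_add Q multihom_minus multihom_expand)
    qed
  qed
  then show ?thesis using ex_below by blast
qed

end


section \<open>The refined filtration\<close>

context twisted_dickson
begin

text \<open>
  Restricting the tuple to the indices below \<open>f\<close> makes the set of tuples with bounded entries finite.
\<close>

definition exponents :: "(var \<Rightarrow>\<^sub>0 nat) \<Rightarrow> nat \<Rightarrow> nat"
  where "exponents m = restrict (expn m) {..<f}"

text \<open>
  For a downward closed set \<open>D\<close> this is the degree \<open>r\<close> part of the ideal generated by the \<open>\<theta>\<^sup>j\<close> with
  \<open>j \<notin> D\<close>.  Indexing by the complement has the advantage that the sets involved are finite.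
\<close>

definition theta_filt :: "(nat \<Rightarrow> nat) \<Rightarrow> (nat \<Rightarrow> nat) set \<Rightarrow> 'a::comm_ring_1 mpoly set"
  where "theta_filt r D =
    expand ` {Q \<in> multihom f r. \<forall>m\<in>Poly_Mapping.keys Q. exponents m \<notin> D}"

lemma theta_filt_zero: "0 \<in> theta_filt r D"
  unfolding theta_filt_def
  by (rule image_eqI[of _ _ 0]) (simp_all add: expand_zero multihom_zero)

lemma theta_filt_add:
  assumes "P \<in> theta_filt r D" "Q \<in> theta_filt r D"
  shows "P + Q \<in> theta_filt r D"
proof -
  obtain P' Q' where "P = expand P'" "Q = expand Q'" "P' \<in> multihom f r" "Q' \<in> multihom f r"
    "\<forall>m\<in>Poly_Mapping.keys P'. exponents m \<notin> D" "\<forall>m\<in>Poly_Mapping.keys Q'. exponents m \<notin> D"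
    using assms by (auto simp: theta_filt_def)
  then show ?thesis unfolding theta_filt_def
    by (intro image_eqI[of _ _ "P' + Q'"])
      (use keys_add[of P' Q'] in \<open>auto simp: expand_add multihom_add\<close>)
qed

lemma theta_filt_sum: "(\<And>i. i \<in> A \<Longrightarrow> P i \<in> theta_filt r D) \<Longrightarrow> sum P A \<in> theta_filt r D"
  by (induction A rule: infinite_finite_induct) (auto simp: theta_filt_add theta_filt_zero)

lemma theta_filt_Const_mult:
  assumes "P \<in> theta_filt r D"
  shows "Const c * P \<in> theta_filt r D"
proof -
  obtain P' where "P = expand P'" "P' \<in> multihom f r" "\<forall>m\<in>Poly_Mapping.keys P'. exponents m \<notin> D"
    using assms by (auto simp: theta_filt_def)
  then show ?thesis unfolding theta_filt_def
    by (intro image_eqI[of _ _ "Const c * P'"])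
      (use keys_Const_mult[of c P'] in \<open>auto simp: expand_Const_mult multihom_Const_mult\<close>)
qed

lemma theta_filt_monom:
  "has_multidegree f r m \<Longrightarrow> exponents m \<notin> D \<Longrightarrow> theta_monom m \<in> theta_filt r D"
  unfolding theta_filt_def
  by (intro image_eqI[of _ _ "Poly_Mapping.single m 1"])
    (auto simp: expand_single Const.hom_one multihom_single)

lemma theta_filt_antimono: "D' \<subseteq> D \<Longrightarrow> theta_filt r D \<subseteq> theta_filt r D'"
  by (auto simp: theta_filt_def)

lemma theta_filt_subset: "theta_filt r D \<subseteq> multihom f r"
  by (auto simp: theta_filt_def multihom_expand)

lemma theta_filt_empty: "theta_filt r {} = multihom f r"
  using expand_surj by (force simp: theta_filt_def multihom_expand)

lemma expand_mem_theta_filt: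
  "expand Q \<in> theta_filt r D \<longleftrightarrow> Q \<in> multihom f r \<and> (\<forall>m\<in>Poly_Mapping.keys Q. exponents m \<notin> D)"
  by (auto simp: theta_filt_def expand_inject)

lemma V_filt_add:
  assumes "P \<in> V_filt p f r k" "Q \<in> V_filt p f r k"
  shows "P + Q \<in> V_filt p f r k"
proof -
  obtain P' Q' where P': "P = (\<Sum>i<f. P' i)" "\<forall>i<f. P' i \<in> multiples f r (dickson p f i ^ k)"
    and Q': "Q = (\<Sum>i<f. Q' i)" "\<forall>i<f. Q' i \<in> multiples f r (dickson p f i ^ k)"
    using assms by (auto simp: V_filt_def)
  then have "P + Q = (\<Sum>i<f. P' i + Q' i)"
    "\<forall>i<f. P' i + Q' i \<in> multiples f r (dickson p f i ^ k)"
    by (auto simp: multiples_def multihom_add sum.distrib)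
  then show ?thesis unfolding V_filt_def by (intro CollectI exI[of _ "\<lambda>i. P' i + Q' i"]) simp
qed

lemma multiples_subset_V_filt:
  assumes "i < f" "P \<in> multiples f r (dickson p f i ^ k)"
  shows "P \<in> V_filt p f r k"
  unfolding V_filt_def
proof (intro CollectI exI[of _ "\<lambda>i'. if i' = i then P else 0"] conjI allI impI)
  show "P = (\<Sum>i'<f. if i' = i then P else 0)" using assms by simp
qed (use assms in \<open>simp add: multiples_def multihom_zero\<close>)

lemma exponents_notin_box:
  "exponents m \<notin> {..<f} \<rightarrow>\<^sub>E {..<k} \<longleftrightarrow> (\<exists>i<f. k \<le> expn m i)"
  by (auto simp: exponents_def PiE_iff not_less)

text \<open>
  For the inclusion from left to right, write a multiple \<open>P\<close> of the \<open>k\<close>-th power of \<open>\<theta>\<^sub>i\<close> as the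
  expansion of \<open>Q\<close>, and its cofactor, homogeneous or not, as the expansion of some \<open>h\<close>.  By injectivity
  \<open>Q\<close> is \<open>h\<close> times the \<open>k\<close>-th power of \<open>u\<^sub>i\<close>.
\<close>

lemma V_filt_eq: "V_filt p f r k = (theta_filt r ({..<f} \<rightarrow>\<^sub>E {..<k}) :: 'a::comm_ring_1 mpoly set)"
proof
  note exps = exponents_notin_box
  show "V_filt p f r k \<subseteq> (theta_filt r ({..<f} \<rightarrow>\<^sub>E {..<k}) :: 'a mpoly set)"
  proof
    fix P :: "'a mpoly" assume "P \<in> V_filt p f r k"
    then obtain P' where P': "P = (\<Sum>i<f. P' i)" "\<forall>i<f. P' i \<in> multiples f r (dickson p f i ^ k)"
      by (auto simp: V_filt_def)
    have "P' i \<in> theta_filt r ({..<f} \<rightarrow>\<^sub>E {..<k})" if i: "i < f" for i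
    proof -
      define j where "j = (\<lambda>i'. if i' = i then k else 0)"
      have "theta j = (dickson p f i ^ k :: 'a mpoly)"
        using i by (simp add: theta_def j_def if_distrib[of "\<lambda>n. _ ^ n"] cong: if_cong)
      moreover obtain h where "P' i = dickson p f i ^ k * h" and hom: "P' i \<in> multihom f r"
        using P'(2) i unfolding multiples_def dvd_def by blast
      moreover obtain h' where "h = expand h'" using expand_surj[of h] by blast
      ultimately have eq: "P' i = expand (Poly_Mapping.single (lead j) 1 * h')"
        by (simp add: expand_lead_mult)
      obtain Q where Q: "expand Q = P' i" "Q \<in> multihom f r" using expand_surj[of "P' i"] hom by blast
      have "Q = Poly_Mapping.single (lead j) 1 * h'" using Q eq by (simp add: expand_inject)
      have "k \<le> expn m i" if m: "m \<in> Poly_Mapping.keys Q" for m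
      proof -
        obtain n where "m = lead j + n"
          using keys_mult[of "Poly_Mapping.single (lead j) 1" h'] m
          unfolding \<open>Q = _\<close> by auto
        then show ?thesis using i by (simp add: expn_lead_add j_def)
      qed
      then show ?thesis
        unfolding Q(1)[symmetric] expand_mem_theta_filt exps using i Q(2) by blast
    qed
    then show "P \<in> theta_filt r ({..<f} \<rightarrow>\<^sub>E {..<k})" unfolding P'(1) by (intro theta_filt_sum) simp
  qed
  show "(theta_filt r ({..<f} \<rightarrow>\<^sub>E {..<k}) :: 'a mpoly set) \<subseteq> V_filt p f r k"
  proof
    fix P :: "'a mpoly" assume "P \<in> theta_filt r ({..<f} \<rightarrow>\<^sub>E {..<k})"
    then obtain Q where Q: "P = expand Q" "Q \<in> multihom f r"
      "\<And>m. m \<in> Poly_Mapping.keys Q \<Longrightarrow> \<exists>i<f. k \<le> expn m i"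
      unfolding theta_filt_def exps by auto
    have mon: "Const c * theta_monom m \<in> V_filt p f r k" if m: "m \<in> Poly_Mapping.keys Q" for m and c :: 'a
    proof -
      obtain i where i: "i < f" "k \<le> expn m i" using Q(3)[OF m] by blast
      have "dickson p f i ^ k dvd (dickson p f i ^ expn m i :: 'a mpoly)"
        using i(2) by (rule le_imp_power_dvd)
      also have "\<dots> dvd theta (expn m)"
        unfolding theta_def using i(1) by (intro dvd_prodI) auto
      finally have "dickson p f i ^ k dvd Const c * theta_monom m"
        by (simp add: theta_monom_def)
      moreover have "Const c * theta_monom m \<in> multihom f r"
        using Q(2) m by (intro multihom_Const_mult multihom_theta_monom) (simp add: multihom_iff)
      ultimately show ?thesis using i(1) by (intro multiples_subset_V_filt[of i]) (auto simp: multiples_def)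
    qed
    have "0 \<in> multiples f r (dickson p f 0 ^ k :: 'a mpoly)" by (simp add: multiples_def multihom_zero)
    then have zero: "0 \<in> (V_filt p f r k :: 'a mpoly set)"
      using f_pos multiples_subset_V_filt by blast
    have "(\<Sum>m\<in>A. Const (Poly_Mapping.lookup Q m) * theta_monom m) \<in> V_filt p f r k"
      if "finite A" "A \<subseteq> Poly_Mapping.keys Q" for A
      using that by (induction A) (auto simp: zero mon V_filt_add)
    then show "P \<in> V_filt p f r k" by (simp add: Q(1) expand_eq)
  qed
qed

text \<open>
  Tuples are functions that are undefined from \<open>f\<close> on, hence the restriction to extensional ones.
\<close>

definition downclosed :: "(nat \<Rightarrow> nat) set \<Rightarrow> bool"
  where "downclosed D \<longleftrightarrow> D \<subseteq> extensional {..<f} \<and>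
    (\<forall>j\<in>D. \<forall>j'\<in>extensional {..<f}. (\<forall>i<f. j' i \<le> j i) \<longrightarrow> j' \<in> D)"

text \<open>
  Multiplication by \<open>u\<^sup>j\<close> makes every tuple at least \<open>j\<close>, and no such tuple lies in \<open>D\<close>.
\<close>

lemma theta_mult_mem:
  assumes D: "downclosed D" and j: "restrict j {..<f} \<notin> D" and Q: "Q \<in> multihom f s"
    and r: "\<And>k. k < f \<Longrightarrow> r k = theta_degree j k + s k"
  shows "theta j * Q \<in> theta_filt r D"
proof -
  obtain Q' where Q': "expand Q' = Q" "Q' \<in> multihom f s" using expand_surj[of Q] Q by blast
  define R where "R = Poly_Mapping.single (lead j) 1 * Q'"
  have R: "theta j * Q = expand R" by (simp add: Q' R_def expand_lead_mult)
  have "has_multidegree f r m \<and> exponents m \<notin> D" if m: "m \<in> Poly_Mapping.keys R" for m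
  proof -
    obtain n where n: "m = lead j + n" "n \<in> Poly_Mapping.keys Q'"
      using keys_mult[of "Poly_Mapping.single (lead j) 1" Q'] m unfolding R_def by auto
    then have "has_multidegree f r m"
      using Q'(2) r by (subst n(1), subst has_multidegree_lead_add[of r j s]) (auto simp: multihom_iff)
    moreover have "exponents m \<notin> D"
    proof
      assume "exponents m \<in> D"
      moreover have "\<forall>i<f. restrict j {..<f} i \<le> exponents m i"
        by (simp add: exponents_def n expn_lead_add)
      ultimately have "restrict j {..<f} \<in> D" using D by (auto simp: downclosed_def)
      then show False using j by blast
    qed
    ultimately show ?thesis by blast
  qed
  then show ?thesis unfolding R expand_mem_theta_filt by (auto simp: multihom_iff)
qed

text \<open>
  This replaces the argument that the \<open>\<theta>\<^sub>i\<close> form a regular sequence.  After undoing the expansion, a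
  monomial \<open>n\<close> of \<open>Q\<close> becomes the monomial \<open>u\<^sup>j n\<close>, and its tuple \<open>j + j'\<close> lies outside \<open>D\<close> if
  and only if \<open>j' \<noteq> 0\<close>: it lies outside \<open>D - {j}\<close> anyway, since that set is downward closed and does not
  contain \<open>j\<close>.
\<close>

lemma theta_mult_mem_iff:
  assumes D: "downclosed (D - {j})" and jD: "j \<in> D" "j \<in> extensional {..<f}" and Q: "Q \<in> multihom f s"
    and r: "\<And>k. k < f \<Longrightarrow> r k = theta_degree j k + s k"
  shows "theta j * Q \<in> theta_filt r D \<longleftrightarrow> Q \<in> V_filt p f s 1"
proof -
  obtain Q' where Q': "Q = expand Q'" "Q' \<in> multihom f s" using expand_surj[of Q] Q by blast
  define R where "R = Poly_Mapping.single (lead j) 1 * Q'"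
  have R: "theta j * Q = expand R" by (simp add: Q' R_def expand_lead_mult)
  have lookup_R: "Poly_Mapping.lookup R (lead j + n) = Poly_Mapping.lookup Q' n" for n
  proof -
    have "R = (\<Sum>m\<in>Poly_Mapping.keys Q'. Poly_Mapping.single (lead j + m) (Poly_Mapping.lookup Q' m))"
      unfolding R_def by (subst (1) mpoly_eq_sum_monomials[of Q'])
        (simp add: sum_distrib_left mult_single)
    then show ?thesis by (simp add: lookup_sum lookup_single when_def in_keys_iff)
  qed
  have keys_R: "Poly_Mapping.keys R = (\<lambda>n. lead j + n) ` Poly_Mapping.keys Q'"
  proof
    show "Poly_Mapping.keys R \<subseteq> (\<lambda>n. lead j + n) ` Poly_Mapping.keys Q'"
      using keys_mult[of "Poly_Mapping.single (lead j) 1" Q'] unfolding R_def by auto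
    show "(\<lambda>n. lead j + n) ` Poly_Mapping.keys Q' \<subseteq> Poly_Mapping.keys R"
      by (auto simp: in_keys_iff lookup_R)
  qed
  have hom: "R \<in> multihom f r"
    using Q'(2) r by (auto simp: multihom_iff keys_R has_multidegree_lead_add[of r j s])
  have "exponents (lead j + n) \<notin> D \<longleftrightarrow> exponents n \<notin> {..<f} \<rightarrow>\<^sub>E {..<1}" for n
  proof -
    have a: "(\<exists>i<f. expn n i \<noteq> 0) \<longleftrightarrow> exponents (lead j + n) \<noteq> j"
    proof
      assume "\<exists>i<f. expn n i \<noteq> 0"
      then obtain i where "i < f" "expn n i \<noteq> 0" by blast
      then have "exponents (lead j + n) i \<noteq> j i" by (simp add: exponents_def expn_lead_add)
      then show "exponents (lead j + n) \<noteq> j" by metis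
    next
      assume ne: "exponents (lead j + n) \<noteq> j"
      have "\<exists>i<f. exponents (lead j + n) i \<noteq> j i"
        using ne jD(2) extensionalityI[of "exponents (lead j + n)" "{..<f}" j]
        by (auto simp: exponents_def)
      then show "\<exists>i<f. expn n i \<noteq> 0" by (auto simp: exponents_def expn_lead_add)
    qed
    have b: "exponents (lead j + n) \<notin> D - {j}"
    proof
      assume "exponents (lead j + n) \<in> D - {j}"
      moreover have "\<forall>i<f. j i \<le> exponents (lead j + n) i"
        by (simp add: exponents_def expn_lead_add)
      ultimately have "j \<in> D - {j}" using D jD(2) unfolding downclosed_def by blast
      then show False by blast
    qed
    have "exponents (lead j + n) \<notin> D \<longleftrightarrow> exponents (lead j + n) \<noteq> j" using b jD(1) by auto
    also have "\<dots> \<longleftrightarrow> exponents n \<notin> {..<f} \<rightarrow>\<^sub>E {..<1}"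
      unfolding a[symmetric] exponents_notin_box Suc_le_eq One_nat_def neq0_conv ..
    finally show ?thesis .
  qed
  then show ?thesis
    unfolding R unfolding V_filt_eq Q'(1) expand_mem_theta_filt using hom Q'(2) by (simp add: keys_R)
qed

text \<open>
  If \<open>P\<close> is the expansion of \<open>R\<close>, the monomials of \<open>R\<close> with tuple \<open>j\<close> have the form \<open>u\<^sup>j n\<close> and
  contribute a multiple of \<open>\<theta>\<^sup>j\<close>; the tuples of all others lie outside \<open>D\<close>.
\<close>

lemma theta_filt_cover:
  fixes P :: "'a::comm_ring_1 mpoly"
  assumes P: "P \<in> theta_filt r (D - {j})"
    and r: "\<And>k. k < f \<Longrightarrow> r k = theta_degree j k + s k"
  shows "\<exists>Q\<in>multihom f s. P - theta j * Q \<in> theta_filt r D"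
proof -
  obtain R where R: "P = expand R" "R \<in> multihom f r"
    "\<And>m. m \<in> Poly_Mapping.keys R \<Longrightarrow> exponents m \<notin> D - {j}"
    using P by (auto simp: theta_filt_def)
  define A where "A = {m \<in> Poly_Mapping.keys R. exponents m = j}"
  define Q where "Q = (\<Sum>m\<in>A. Const (Poly_Mapping.lookup R m) * Poly_Mapping.single (normal_part m) 1)"
  have monom: "(theta_monom m :: 'a mpoly) = theta j * Poly_Mapping.single (normal_part m) 1"
    and leadA: "m = lead j + normal_part m" if "m \<in> A" for m
  proof -
    have eq: "j i = expn m i" if "i < f" for i
      using \<open>m \<in> A\<close> that by (auto simp: A_def exponents_def)
    then have "(theta j :: 'a mpoly) = theta (expn m)" by (rule theta_cong)
    then show "(theta_monom m :: 'a mpoly) = theta j * Poly_Mapping.single (normal_part m) 1"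
      by (simp add: theta_monom_def)
    have "lead j = lead (expn m)" using eq by (rule lead_cong)
    then show "m = lead j + normal_part m" using normal_part_add[of m] by (simp add: add.commute)
  qed
  have "Q \<in> multihom f s"
    unfolding Q_def
  proof (intro multihom_sum multihom_Const_mult multihom_single)
    fix m assume m: "m \<in> A"
    then have "has_multidegree f r m" using R(2) by (auto simp: A_def multihom_iff)
    then show "has_multidegree f s (normal_part m)"
      using has_multidegree_lead_add[of r j s "normal_part m"] r leadA[OF m] by simp
  qed
  moreover have "P - theta j * Q \<in> theta_filt r D"
  proof -
    have "theta j * Q = (\<Sum>m\<in>A. Const (Poly_Mapping.lookup R m) * theta_monom m)"
      unfolding Q_def sum_distrib_left by (rule sum.cong) (simp_all add: monom mult_ac)
    moreover have "P = (\<Sum>m\<in>Poly_Mapping.keys R - A. Const (Poly_Mapping.lookup R m) * theta_monom m)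
        + (\<Sum>m\<in>A. Const (Poly_Mapping.lookup R m) * theta_monom m)"
      unfolding R(1) expand_eq by (rule sum.subset_diff) (auto simp: A_def)
    ultimately have "P - theta j * Q =
        (\<Sum>m\<in>Poly_Mapping.keys R - A. Const (Poly_Mapping.lookup R m) * theta_monom m)" by simp
    also have "\<dots> \<in> theta_filt r D"
      using R by (intro theta_filt_sum theta_filt_Const_mult theta_filt_monom)
        (auto simp: A_def multihom_iff)
    finally show ?thesis .
  qed
  ultimately show ?thesis by blast
qed

text \<open>
  The basis elements \<open>\<theta>\<^sup>j n\<close> are not permuted by \<open>F\<close>, but \<open>F\<close> maps them to multiples of \<open>\<theta>\<^sup>j\<close>, all
  of which lie in the ideal.
\<close>

lemma theta_filt_stable:
  fixes F :: "'a::comm_ring_1 mpoly \<Rightarrow> 'a mpoly"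
  assumes F: "unital_ring_hom F" and FC: "\<And>c. F (Const c) = Const c"
    and F_dickson: "\<And>i. i < f \<Longrightarrow> F (dickson p f i) = Const (c i) * dickson p f i"
    and F_hom: "\<And>s P. P \<in> multihom f s \<Longrightarrow> F P \<in> multihom f s"
    and D: "downclosed D" and P: "P \<in> theta_filt r D"
  shows "F P \<in> theta_filt r D"
proof -
  interpret F: unital_ring_hom F by fact
  obtain R where R: "P = expand R" "R \<in> multihom f r"
    "\<And>m. m \<in> Poly_Mapping.keys R \<Longrightarrow> exponents m \<notin> D"
    using P by (auto simp: theta_filt_def)
  have "F P = (\<Sum>m\<in>Poly_Mapping.keys R. Const (Poly_Mapping.lookup R m) * F (theta_monom m))"
    by (simp add: R(1) expand_eq F.hom_sum F.hom_mult FC)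
  also have "\<dots> \<in> theta_filt r D"
  proof (intro theta_filt_sum theta_filt_Const_mult)
    fix m assume m: "m \<in> Poly_Mapping.keys R"
    then have "has_multidegree f r m" using R(2) by (simp add: multihom_iff)
    then show "F (theta_monom m) \<in> theta_filt r D"
    proof (rule normal_part_multidegree)
      fix s assume r: "\<And>k. k < f \<Longrightarrow> r k = theta_degree (expn m) k + s k"
        and n: "has_multidegree f s (normal_part m)"
      have "F (theta (expn m)) = Const (\<Prod>i<f. c i ^ expn m i) * theta (expn m)"
        by (simp add: theta_def F.hom_prod F.hom_power F_dickson power_mult_distrib prod.distrib
          Const.hom_prod Const.hom_power)
      then have "F (theta_monom m) = Const (\<Prod>i<f. c i ^ expn m i) *
          (theta (expn m) * F (Poly_Mapping.single (normal_part m) 1))"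
        by (simp add: theta_monom_def F.hom_mult mult.assoc)
      also have "\<dots> \<in> theta_filt r D"
        using R(3)[OF m] r n
        by (intro theta_filt_Const_mult theta_mult_mem[where s = s] D F_hom multihom_single)
          (auto simp: exponents_def)
      finally show ?thesis .
    qed
  qed
  finally show ?thesis .
qed

lemma downclosed_box: "downclosed ({..<f} \<rightarrow>\<^sub>E {..<k})"
  by (force simp: downclosed_def PiE_iff intro: le_less_trans)

text \<open>
  Remove, among the tuples outside \<open>D'\<close>, one with maximal sum of entries.  No other tuple of \<open>D\<close> lies
  above it: such a tuple would have a larger sum, and be outside \<open>D'\<close> because \<open>D'\<close> is downward closed.
\<close>

lemma downclosed_chain:
  assumes "downclosed D" "downclosed D'" "D' \<subseteq> D" "finite (D - D')"
  shows "\<exists>E. E 0 = D \<and> E (card (D - D')) = D' \<and> (\<forall>i\<le>card (D - D'). downclosed (E i)) \<and>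
    (\<forall>i<card (D - D'). \<exists>j\<in>E i. E (Suc i) = E i - {j} \<and> j \<in> D)"
  using assms(4,1,3)
proof (induction "D - D'" arbitrary: D rule: finite_psubset_induct)
  case psubset
  show ?case
  proof (cases "D = D'")
    case True
    then show ?thesis using assms(2) by (intro exI[of _ "\<lambda>_. D'"]) simp
  next
    case False
    define w where "w j = (\<Sum>i<f. j i)" for j :: "nat \<Rightarrow> nat"
    have fin: "finite (D - D')" by fact
    have "D - D' \<noteq> {}" using False \<open>D' \<subseteq> D\<close> by auto
    then have "Max (w ` (D - D')) \<in> w ` (D - D')" using fin by (intro Max_in) auto
    then obtain j where j: "j \<in> D - D'" and "w j = Max (w ` (D - D'))" by auto
    then have max: "w j' \<le> w j" if "j' \<in> D - D'" for j' using that fin by simp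
    have down: "downclosed (D - {j})"
      unfolding downclosed_def
    proof (intro conjI ballI impI)
      show "D - {j} \<subseteq> extensional {..<f}" using \<open>downclosed D\<close> by (auto simp: downclosed_def)
      fix a b assume a: "a \<in> D - {j}" and b: "b \<in> extensional {..<f}" "\<forall>i<f. b i \<le> a i"
      have "b \<in> D" using a b \<open>downclosed D\<close> unfolding downclosed_def by blast
      moreover have "b \<noteq> j"
      proof
        assume "b = j"
        have "a \<notin> D'" using assms(2) b j \<open>b = j\<close> unfolding downclosed_def by blast
        then have "w a \<le> w j" using a by (intro max) auto
        moreover have "w j \<le> w a" unfolding w_def using b \<open>b = j\<close> by (intro sum_mono) auto
        ultimately have "(\<Sum>i<f. j i) = (\<Sum>i<f. a i)" by (simp add: w_def)
        then have "\<forall>i<f. a i = j i"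
          using sum_mono_inv[of j "{..<f}" a] b \<open>b = j\<close> by force
        moreover have "a \<in> extensional {..<f}" using a \<open>downclosed D\<close> by (auto simp: downclosed_def)
        ultimately have "a = j" using b \<open>b = j\<close> by (intro extensionalityI[of _ "{..<f}"]) auto
        then show False using a by simp
      qed
      ultimately show "b \<in> D - {j}" by simp
    qed
    have eq: "D - {j} - D' = (D - D') - {j}" by auto
    have "card (D - D') = Suc (card (D - {j} - D'))"
      unfolding eq using fin j by (rule card.remove)
    moreover have "D - {j} - D' \<subset> D - D'" "D' \<subseteq> D - {j}" using j \<open>D' \<subseteq> D\<close> by auto
    note psubset(2)[OF this(1) down this(2)]
    then obtain E where E: "E 0 = D - {j}" "E (card (D - {j} - D')) = D'"
      "\<forall>i\<le>card (D - {j} - D'). downclosed (E i)"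
      "\<forall>i<card (D - {j} - D'). \<exists>j'\<in>E i. E (Suc i) = E i - {j'} \<and> j' \<in> D - {j}" by blast
    ultimately show ?thesis
      using \<open>downclosed D\<close> j
      by (intro exI[of _ "\<lambda>i. case i of 0 \<Rightarrow> D | Suc i \<Rightarrow> E i"])
        (auto split: nat.splits simp: less_Suc_eq_0_disj, blast)
  qed
qed

end


section \<open>Evaluation at the points of the projective line\<close>

lemma power_card_minus_one:
  fixes x :: "'a::{field,finite}"
  assumes "x \<noteq> 0"
  shows "x ^ (CARD('a) - 1) = 1"
proof -
  have "bij_betw ((*) x) (UNIV - {0}) (UNIV - {0})"
    by (rule bij_betw_byWitness[where f' = "\<lambda>y. y / x"]) (use assms in auto)
  then have "(\<Prod>y\<in>UNIV - {0}. x * y) = (\<Prod>y\<in>UNIV - {0}. y)"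
    by (rule prod.reindex_bij_betw)
  then have "x ^ (CARD('a) - 1) * (\<Prod>y\<in>UNIV - {0::'a}. y) = (\<Prod>y\<in>UNIV - {0}. y)"
    by (simp add: prod.distrib card_Diff_singleton)
  then show ?thesis by simp
qed

lemma power_card:
  fixes x :: "'a::{field,finite}"
  shows "x ^ CARD('a) = x"
proof (cases "x = 0")
  case False
  have "x ^ CARD('a) = x ^ Suc (CARD('a) - 1)" by simp
  then show ?thesis using power_card_minus_one[OF False] by (simp del: Suc_pred)
qed simp

text \<open>
  The polynomial \<open>1 - (X - a)\<close> to the \<open>q - 1\<close> is 1 at \<open>a\<close> and 0 elsewhere.
\<close>

lemma interpolation:
  fixes \<phi> :: "'a::{field,finite} \<Rightarrow> 'a"
  shows "\<exists>g. degree g < CARD('a) \<and> (\<forall>t. poly g t = \<phi> t)"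
proof -
  define q where "q = CARD('a)"
  have q: "0 < q" "1 < q"
    using card_mono[of "UNIV :: 'a set" "{0, 1}"] by (auto simp: q_def)
  define g where "g = (\<Sum>a\<in>UNIV. smult (\<phi> a) (1 - [:- a, 1:] ^ (q - 1)))"
  have "degree (1 - [:- a, 1:] ^ (q - 1)) \<le> q - 1" for a :: 'a
    by (intro degree_diff_le) (simp_all add: degree_linear_power)
  then have "degree g \<le> q - 1"
    unfolding g_def by (intro degree_sum_le) (auto intro: order_trans[OF degree_smult_le])
  moreover have "poly g t = \<phi> t" for t
  proof -
    have "poly g t = (\<Sum>a\<in>UNIV. \<phi> a * (1 - (t - a) ^ (q - 1)))"
      by (simp add: g_def poly_sum)
    also have "\<dots> = (\<Sum>a\<in>UNIV. if a = t then \<phi> a else 0)"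
    proof (rule sum.cong)
      fix a
      have "(t - a) ^ (q - 1) = 1" if "a \<noteq> t"
        using that power_card_minus_one[of "t - a"] by (simp add: q_def)
      then show "\<phi> a * (1 - (t - a) ^ (q - 1)) = (if a = t then \<phi> a else 0)"
        using q by simp
    qed simp
    finally show ?thesis by simp
  qed
  moreover have "q - 1 < CARD('a)" using q by (simp add: q_def)
  ultimately show ?thesis by (meson le_less_trans)
qed

lemma poly_zero_if_vanishing:
  fixes g :: "'a::{field,finite} poly"
  assumes "degree g < CARD('a)" "\<And>t. poly g t = 0"
  shows "g = 0"
proof (rule ccontr)
  assume "g \<noteq> 0"
  then have "card {t. poly g t = 0} \<le> degree g" by (rule card_poly_roots_bound)
  then show False using assms by simp
qed

lemma digit_sum_Suc:
  "(\<Sum>i<Suc f. b i * p ^ i) = b 0 + p * (\<Sum>i<f. b (Suc i) * p ^ i :: nat)"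
  by (subst sum.lessThan_Suc_shift) (simp add: sum_distrib_left mult_ac)

lemma digit_sum_less:
  fixes b :: "nat \<Rightarrow> nat"
  assumes "\<And>i. i < f \<Longrightarrow> b i < p"
  shows "(\<Sum>i<f. b i * p ^ i) < p ^ f"
  using assms
proof (induction f arbitrary: b)
  case (Suc f)
  have "(\<Sum>i<f. b (Suc i) * p ^ i) < p ^ f" using Suc.prems by (intro Suc.IH) simp
  then have "p * Suc (\<Sum>i<f. b (Suc i) * p ^ i) \<le> p * p ^ f" by (intro mult_left_mono) auto
  then show ?case unfolding digit_sum_Suc using Suc.prems[of 0] by simp
qed simp

lemma digit_of_sum:
  fixes b :: "nat \<Rightarrow> nat"
  assumes "\<And>i. i < f \<Longrightarrow> b i < p" "k < f"
  shows "(\<Sum>i<f. b i * p ^ i) div p ^ k mod p = b k"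
  using assms
proof (induction f arbitrary: b k)
  case (Suc f)
  have p: "b 0 < p" using Suc.prems(1)[of 0] by simp
  show ?case
  proof (cases k)
    case 0
    then show ?thesis unfolding digit_sum_Suc using p by simp
  next
    case k: (Suc k')
    have "(\<Sum>i<f. b (Suc i) * p ^ i) div p ^ k' mod p = b (Suc k')"
      using Suc.prems k by (intro Suc.IH) auto
    then show ?thesis unfolding digit_sum_Suc k using p by (simp add: div_mult2_eq)
  qed
qed simp

lemma sum_of_digits:
  fixes n p :: nat
  assumes "n < p ^ f"
  shows "(\<Sum>i<f. n div p ^ i mod p * p ^ i) = n"
  using assms
proof (induction f arbitrary: n)
  case (Suc f)
  have "n div p < p ^ f" using Suc.prems by (simp add: less_mult_imp_div_less mult.commute)
  then have "(\<Sum>i<f. n div p div p ^ i mod p * p ^ i) = n div p" by (rule Suc.IH)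
  then show ?case unfolding digit_sum_Suc by (simp add: div_mult2_eq)
qed simp

text \<open>
  The values of the variables at a point of the plane over the field: the group acts on \<open>x\<^sub>i\<close>, \<open>y\<^sub>i\<close> through
  the \<open>i\<close>-th power of the Frobenius, so evaluating there is compatible with the action on row vectors.
\<close>

definition frob_point :: "nat \<Rightarrow> 'a::comm_ring_1 \<Rightarrow> 'a \<Rightarrow> var \<Rightarrow> 'a"
  where "frob_point p x y v = (case v of XV i \<Rightarrow> x ^ p ^ i | YV i \<Rightarrow> y ^ p ^ i)"

lemma monom_eval_split:
  assumes "has_multidegree f s m"
  shows "monom_eval \<sigma> m =
    (\<Prod>i<f. \<sigma> (XV i) ^ Poly_Mapping.lookup m (XV i)) * (\<Prod>i<f. \<sigma> (YV i) ^ Poly_Mapping.lookup m (YV i))"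
proof -
  let ?g = "\<lambda>v. \<sigma> v ^ Poly_Mapping.lookup m v"
  have "monom_eval \<sigma> m = prod ?g (XV ` {..<f} \<union> YV ` {..<f})"
    using assms by (intro monom_eval_superset) (auto simp: has_multidegree_def)
  also have "\<dots> = prod ?g (XV ` {..<f}) * prod ?g (YV ` {..<f})"
    by (rule prod.union_disjoint) auto
  finally show ?thesis by (simp add: prod.reindex inj_on_def)
qed

lemma monom_eval_frob_point:
  assumes "has_multidegree f s m"
  shows "monom_eval (frob_point p x y) m =
    x ^ (\<Sum>i<f. Poly_Mapping.lookup m (XV i) * p ^ i) * y ^ (\<Sum>i<f. Poly_Mapping.lookup m (YV i) * p ^ i)"
  unfolding monom_eval_split[OF assms]
  by (simp add: frob_point_def power_sum mult.commute flip: power_mult)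

lemma poly_eval_eq_sum:
  "poly_eval \<rho> P = (\<Sum>m\<in>Poly_Mapping.keys P. Poly_Mapping.lookup P m * monom_eval \<rho> m)"
  by (simp add: poly_eval_def monom_ext_def)

lemma poly_eval_homogeneous:
  assumes "Q \<in> multihom f s"
  shows "poly_eval (frob_point p (c * x) (c * y)) Q =
    c ^ (\<Sum>i<f. s i * p ^ i) * poly_eval (frob_point p x y) Q"
  unfolding poly_eval_eq_sum sum_distrib_left
proof (rule sum.cong)
  fix m assume "m \<in> Poly_Mapping.keys Q"
  then have m: "has_multidegree f s m" using assms by (simp add: multihom_iff)
  then have "s i = Poly_Mapping.lookup m (XV i) + Poly_Mapping.lookup m (YV i)" if "i < f" for i
    using that by (simp add: has_multidegree_def)
  then have "(\<Sum>i<f. s i * p ^ i) =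
      (\<Sum>i<f. Poly_Mapping.lookup m (XV i) * p ^ i) + (\<Sum>i<f. Poly_Mapping.lookup m (YV i) * p ^ i)"
    by (simp add: distrib_right flip: sum.distrib)
  then show "Poly_Mapping.lookup Q m * monom_eval (frob_point p (c * x) (c * y)) m =
      c ^ (\<Sum>i<f. s i * p ^ i) * (Poly_Mapping.lookup Q m * monom_eval (frob_point p x y) m)"
    unfolding monom_eval_frob_point[OF m] by (simp add: power_add power_mult_distrib mult_ac)
qed simp

definition the_monom :: "nat \<Rightarrow> (nat \<Rightarrow> nat) \<Rightarrow> (nat \<Rightarrow> nat) \<Rightarrow> var \<Rightarrow>\<^sub>0 nat"
  where "the_monom f a b = (\<Sum>i<f. Poly_Mapping.single (XV i) (a i) + Poly_Mapping.single (YV i) (b i))"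

lemma lookup_the_monom:
  "Poly_Mapping.lookup (the_monom f a b) (XV k) = (if k < f then a k else 0)"
  "Poly_Mapping.lookup (the_monom f a b) (YV k) = (if k < f then b k else 0)"
  by (simp_all add: the_monom_def lookup_sum lookup_add lookup_single when_def)

lemma has_multidegree_the_monom:
  assumes "\<And>i. i < f \<Longrightarrow> a i + b i = s i"
  shows "has_multidegree f s (the_monom f a b)"
proof -
  have "v \<in> XV ` {..<f} \<union> YV ` {..<f}" if "v \<in> Poly_Mapping.keys (the_monom f a b)" for v
    using that by (cases v) (auto simp: in_keys_iff lookup_the_monom split: if_splits)
  then show ?thesis using assms by (auto simp: has_multidegree_def lookup_the_monom)
qed

lemma monom_eqI:
  assumes "has_multidegree f s m" "has_multidegree f s n"
    and Y: "\<And>i. i < f \<Longrightarrow> Poly_Mapping.lookup m (YV i) = Poly_Mapping.lookup n (YV i)"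
  shows "m = n"
proof (rule poly_mapping_eqI)
  fix v
  have out: "Poly_Mapping.lookup l v = 0" if "has_multidegree f s l" "v \<notin> XV ` {..<f} \<union> YV ` {..<f}" for l
    using that by (auto simp: has_multidegree_def in_keys_iff)
  show "Poly_Mapping.lookup m v = Poly_Mapping.lookup n v"
  proof (cases "v \<in> XV ` {..<f} \<union> YV ` {..<f}")
    case True
    then obtain i where "i < f" "v = XV i \<or> v = YV i" by auto
    moreover have "Poly_Mapping.lookup m (XV i) + Poly_Mapping.lookup m (YV i) =
        Poly_Mapping.lookup n (XV i) + Poly_Mapping.lookup n (YV i)"
      using assms(1,2) \<open>i < f\<close> by (simp add: has_multidegree_def)
    ultimately show ?thesis using Y by auto
  qed (use out assms in simp)
qed

context twisted_dickson
begin

text \<open>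
  Keep the part of the expansion that involves no \<open>\<theta>\<^sub>i\<close>.
\<close>

lemma normal_representative:
  fixes Q :: "'a::comm_ring_1 mpoly"
  assumes Q: "Q \<in> multihom f s"
  obtains N where "N \<in> multihom f s" "\<And>m i. m \<in> Poly_Mapping.keys N \<Longrightarrow> i < f \<Longrightarrow> expn m i = 0"
    "Q - N \<in> V_filt p f s 1"
proof -
  obtain R where R: "expand R = Q" "R \<in> multihom f s" using expand_surj[of Q] Q by blast
  define A where "A = {m \<in> Poly_Mapping.keys R. \<forall>i<f. expn m i = 0}"
  define N where "N = (\<Sum>m\<in>A. Poly_Mapping.single m (Poly_Mapping.lookup R m))"
  have lookup_N: "Poly_Mapping.lookup N m = (if m \<in> A then Poly_Mapping.lookup R m else 0)" for m
    by (simp add: N_def lookup_sum lookup_single when_def A_def)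
  have keys_N: "m \<in> A" if "m \<in> Poly_Mapping.keys N" for m
    using that by (auto simp: in_keys_iff lookup_N split: if_splits)
  have hom: "N \<in> multihom f s" using R(2) keys_N by (auto simp: multihom_iff A_def)
  have "expand N = N"
  proof -
    have "(theta_monom m :: 'a mpoly) = Poly_Mapping.single m 1" if "m \<in> A" for m
    proof -
      have z: "expn m i = 0" if "i < f" for i using that \<open>m \<in> A\<close> by (simp add: A_def)
      then have "lead (expn m) = 0" "theta (expn m) = (1 :: 'a mpoly)"
        by (simp_all add: lead_def theta_def)
      then show ?thesis by (simp add: theta_monom_def normal_part_def)
    qed
    then show ?thesis
      by (simp add: N_def expand_sum expand_single Const_mult_single)
  qed
  moreover have "expand (R - N) \<in> V_filt p f s 1"
    unfolding V_filt_eq expand_mem_theta_filt exponents_notin_box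
  proof (intro conjI ballI)
    show "R - N \<in> multihom f s" using R(2) hom by (rule multihom_minus)
    fix m assume m: "m \<in> Poly_Mapping.keys (R - N)"
    then have "m \<notin> A" "m \<in> Poly_Mapping.keys R"
      by (auto simp: in_keys_iff lookup_minus lookup_N split: if_splits)
    then show "\<exists>i<f. 1 \<le> expn m i" by (auto simp: A_def Suc_le_eq)
  qed
  ultimately have diff: "Q - N \<in> V_filt p f s 1" by (simp add: expand_minus R)
  have "expn m i = 0" if "m \<in> Poly_Mapping.keys N" "i < f" for m i
    using keys_N[OF that(1)] that(2) by (simp add: A_def)
  then show ?thesis using that[OF hom _ diff] by blast
qed

text \<open>
  Normality says that for every \<open>i\<close> the exponent of \<open>x\<^sub>i\<close> is 0 or that of \<open>y\<^sub>i\<^sub>-\<^sub>1\<close> is less than \<open>p\<close>.  If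
  the exponent of \<open>x\<^sub>i\<close> is 0, that of \<open>y\<^sub>i\<close> is \<open>s\<^sub>i \<ge> p\<close>, so that of \<open>x\<^sub>i\<^sub>+\<^sub>1\<close> is 0 too; going around the
  cycle of indices, none of the \<open>x\<^sub>i\<close> occurs.
\<close>

lemma normal_monomial_cases:
  assumes m: "has_multidegree f s m" and s: "\<And>i. i < f \<Longrightarrow> p \<le> s i"
    and normal: "\<And>i. i < f \<Longrightarrow> expn m i = 0"
  obtains (y_only) "\<And>i. i < f \<Longrightarrow> Poly_Mapping.lookup m (XV i) = 0"
  | (digits) "\<And>i. i < f \<Longrightarrow> Poly_Mapping.lookup m (YV i) < p" "\<And>i. i < f \<Longrightarrow> 0 < Poly_Mapping.lookup m (XV i)"
proof -
  have sum: "Poly_Mapping.lookup m (XV i) + Poly_Mapping.lookup m (YV i) = s i" if "i < f" for i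
    using m that by (simp add: has_multidegree_def)
  have step: "Poly_Mapping.lookup m (XV i) = 0 \<or> Poly_Mapping.lookup m (YV (prv i)) < p" if "i < f" for i
    using normal[OF that] p_gt_1 by (auto simp: expn_def min_def div_eq_0_iff split: if_splits)
  have next_zero: "Poly_Mapping.lookup m (XV i) = 0"
    if "i < f" "Poly_Mapping.lookup m (XV (prv i)) = 0" for i
    using step[OF that(1)] sum[OF prv_less[OF that(1)]] s[OF prv_less[OF that(1)]] that(2) by auto
  show thesis
  proof (cases "\<exists>k<f. Poly_Mapping.lookup m (XV k) = 0")
    case True
    then obtain k where k: "k < f" "Poly_Mapping.lookup m (XV k) = 0" by blast
    have up: "Poly_Mapping.lookup m (XV (k + n)) = 0"
      if "Poly_Mapping.lookup m (XV k) = 0" "k + n < f" for k n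
      using that
    proof (induction n)
      case (Suc n)
      then show ?case using next_zero[of "k + Suc n"] by (simp add: prv_def)
    qed simp
    have "Poly_Mapping.lookup m (XV (f - 1)) = 0" using up[of k "f - 1 - k"] k by simp
    then have "Poly_Mapping.lookup m (XV 0) = 0" using next_zero[of 0] f_pos by (simp add: prv_def)
    then show thesis using up[of 0] by (intro y_only) simp
  next
    case False
    then have pos: "0 < Poly_Mapping.lookup m (XV i)" if "i < f" for i using that by auto
    have "Poly_Mapping.lookup m (YV k) < p" if "k < f" for k
      using prv_surj[OF that] step pos by force
    then show thesis using pos by (rule digits)
  qed
qed

end

text \<open>
  The type token makes the field a parameter; \<open>p\<close> and \<open>f\<close> do not determine the type.
\<close>

locale twisted_dickson_field = twisted_dickson p f for p f +
  fixes F :: "'a::{field,finite} itself"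
  assumes prime_p: "prime p" and card_field: "CARD('a) = p ^ f"
begin

lemma CHAR_field: "CHAR('a) = p"
proof -
  have "prime CHAR('a)"
    using prime_CHAR_semidom[where ?'a = 'a] finite_imp_CHAR_pos[where ?'a = 'a] by simp
  moreover have "CHAR('a) dvd p ^ f" using CHAR_dvd_CARD[where ?'a = 'a] card_field by simp
  ultimately show ?thesis using prime_p by (metis prime_dvd_power primes_dvd_imp_eq)
qed

lemma CHAR_mpoly: "CHAR('a mpoly) = p"
proof -
  have "(of_nat n :: 'a mpoly) = 0 \<longleftrightarrow> (of_nat n :: 'a) = 0" for n
    unfolding single_of_nat[symmetric] by (metis lookup_single_eq lookup_zero single_zero)
  then show ?thesis
    by (intro CHAR_eqI) (simp_all add: of_nat_eq_0_iff_char_dvd CHAR_field)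
qed

lemma frob_add: "(x + y :: 'a) ^ p ^ i = x ^ p ^ i + y ^ p ^ i"
  using prime_p by (intro freshmans_dream') (simp_all add: CHAR_field)

lemma frob_diff: "(x - y :: 'a) ^ p ^ i = x ^ p ^ i - y ^ p ^ i"
  using frob_add[of "x - y" y i] by (simp add: algebra_simps)

lemma mpoly_power_p_add: "(P + Q :: 'a mpoly) ^ p = P ^ p + Q ^ p"
  using prime_p by (intro freshmans_dream) (simp_all add: CHAR_mpoly)

lemma power_field: "(x :: 'a) ^ p ^ f = x"
  using power_card[of x] by (simp add: card_field)

text \<open>
  At \<open>i = 0\<close> the exponent wraps around, and \<open>t\<^sup>q = t\<close> takes care of it.
\<close>

lemma frob_prv: "i < f \<Longrightarrow> ((x :: 'a) ^ p ^ prv i) ^ p = x ^ p ^ i"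
proof (cases i)
  case 0
  have "(x ^ p ^ (f - 1)) ^ p = x ^ (p ^ Suc (f - 1))" by (simp add: mult.commute flip: power_mult)
  then show ?thesis using 0 f_pos power_field by (simp add: prv_def)
qed (simp add: prv_def mult.commute flip: power_mult)

lemma poly_eval_dickson:
  assumes "i < f"
  shows "poly_eval (frob_point p x y) (dickson p f i :: 'a mpoly) = 0"
proof -
  show ?thesis using assms
    by (simp add: dickson_eq poly_eval.hom_minus poly_eval.hom_mult poly_eval.hom_power poly_eval_Var frob_point_def frob_prv)
qed

lemma poly_eval_V_filt:
  assumes "P \<in> V_filt p f s 1"
  shows "poly_eval (frob_point p x y) (P :: 'a mpoly) = 0"
proof -
  obtain P' where P: "P = (\<Sum>i<f. P' i)" and P': "\<And>i. i < f \<Longrightarrow> dickson p f i dvd P' i"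
    using assms by (auto simp: V_filt_def multiples_def)
  have "poly_eval (frob_point p x y) (P' i) = 0" if i: "i < f" for i
  proof -
    obtain h where "P' i = dickson p f i * h" using P'[OF i] by (auto elim: dvdE)
    then show ?thesis using poly_eval_dickson[OF i] by (simp add: poly_eval.hom_mult)
  qed
  then show ?thesis by (simp add: P poly_eval.hom_sum)
qed

text \<open>
  Evaluation at \<open>(0, 1)\<close> sees only the normal monomial without \<open>x\<^sub>i\<close>, which must therefore be absent.
  The others become distinct powers \<open>t\<^sup>n\<close> with \<open>n < q\<close> at \<open>(1, t)\<close>, and a polynomial of degree less than
  \<open>q\<close> with \<open>q\<close> roots is zero.
\<close>

theorem mem_V_filt_one_iff:
  fixes Q :: "'a mpoly"
  assumes Q: "Q \<in> multihom f s" and s: "\<And>i. i < f \<Longrightarrow> p \<le> s i"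
  shows "Q \<in> V_filt p f s 1 \<longleftrightarrow>
    poly_eval (frob_point p 0 1) Q = 0 \<and> (\<forall>t. poly_eval (frob_point p 1 t) Q = 0)"
proof
  assume "Q \<in> V_filt p f s 1"
  then show "poly_eval (frob_point p 0 1) Q = 0 \<and> (\<forall>t. poly_eval (frob_point p 1 t) Q = 0)"
    using poly_eval_V_filt by blast
next
  assume zero: "poly_eval (frob_point p 0 1) Q = 0 \<and> (\<forall>t. poly_eval (frob_point p 1 t) Q = 0)"
  obtain N where N: "N \<in> multihom f s" "Q - N \<in> V_filt p f s 1"
    and normal: "\<And>m i. m \<in> Poly_Mapping.keys N \<Longrightarrow> i < f \<Longrightarrow> expn m i = 0"
    using normal_representative[OF Q] by metis
  have eval_eq: "poly_eval (frob_point p x y) Q = poly_eval (frob_point p x y) N" for x y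
  proof -
      show ?thesis using poly_eval_V_filt[OF N(2), of x y] by (simp add: poly_eval.hom_minus)
  qed
  have deg: "has_multidegree f s m" if "m \<in> Poly_Mapping.keys N" for m
    using N(1) that by (simp add: multihom_iff)
  note cases = normal_monomial_cases[OF deg s normal]
  \<comment> \<open>The exponents of the \<open>y\<^sub>i\<close> are the \<open>p\<close>-adic digits of \<open>code m\<close>, the exponent of \<open>t\<close> in the value at \<open>(1, t)\<close>.\<close>
  define code where "code m = (\<Sum>i<f. Poly_Mapping.lookup m (YV i) * p ^ i)" for m
  have digit_monomial: "Poly_Mapping.lookup m (YV i) < p \<and> 0 < Poly_Mapping.lookup m (XV i)"
    if m: "m \<in> Poly_Mapping.keys N" "i < f" for m i
  proof (rule cases[OF m(1) _ m(1)])
    assume y_only: "\<And>i. i < f \<Longrightarrow> Poly_Mapping.lookup m (XV i) = 0"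
    have eval_monom: "monom_eval (frob_point p 0 1) n = (if n = m then 1 else 0 :: 'a)"
      if n: "n \<in> Poly_Mapping.keys N" for n
    proof (rule cases[OF n _ n])
      assume y: "\<And>i. i < f \<Longrightarrow> Poly_Mapping.lookup n (XV i) = 0"
      have "Poly_Mapping.lookup n (YV i) = Poly_Mapping.lookup m (YV i)" if "i < f" for i
      proof -
        have "Poly_Mapping.lookup l (XV i) + Poly_Mapping.lookup l (YV i) = s i"
          if "l \<in> Poly_Mapping.keys N" for l
          using deg[OF that] \<open>i < f\<close> by (simp add: has_multidegree_def)
        from this[OF n] this[OF m(1)] show ?thesis using y y_only that by simp
      qed
      then have "n = m" using deg[OF n] deg[OF m(1)] by (intro monom_eqI)
      then show ?thesis unfolding monom_eval_frob_point[OF deg[OF n]] using y_only by simp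
    next
      assume "\<And>i. i < f \<Longrightarrow> 0 < Poly_Mapping.lookup n (XV i)"
      then have pos: "0 < Poly_Mapping.lookup n (XV 0)" using f_pos by simp
      then have "n \<noteq> m" using y_only[of 0] f_pos by auto
      moreover have "0 < (\<Sum>i<f. Poly_Mapping.lookup n (XV i) * p ^ i)"
        using pos f_pos by (intro sum_pos2[of _ 0]) auto
      ultimately show ?thesis by (simp add: monom_eval_frob_point[OF deg[OF n]])
    qed
    have "poly_eval (frob_point p 0 1) N = (\<Sum>n\<in>Poly_Mapping.keys N. if n = m then Poly_Mapping.lookup N n else 0)"
      unfolding poly_eval_eq_sum by (rule sum.cong) (simp_all add: eval_monom)
    then have "poly_eval (frob_point p 0 1) N = Poly_Mapping.lookup N m" using m(1) by simp
    then show ?thesis using zero m(1) by (simp add: eval_eq in_keys_iff)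
  qed (use m(2) in auto)
  define g where "g = (\<Sum>m\<in>Poly_Mapping.keys N. monom (Poly_Mapping.lookup N m) (code m))"
  have inj: "m = n" if "m \<in> Poly_Mapping.keys N" "n \<in> Poly_Mapping.keys N" "code m = code n" for m n
  proof (rule monom_eqI[OF deg[OF that(1)] deg[OF that(2)]])
    fix i assume i: "i < f"
    have "Poly_Mapping.lookup l (YV i) = code l div p ^ i mod p" if "l \<in> Poly_Mapping.keys N" for l
      unfolding code_def by (rule digit_of_sum[symmetric]) (use digit_monomial that i in auto)
    then show "Poly_Mapping.lookup m (YV i) = Poly_Mapping.lookup n (YV i)" using that by simp
  qed
  have "code m \<le> CARD('a) - 1" if "m \<in> Poly_Mapping.keys N" for m
  proof -
    have "code m < p ^ f" unfolding code_def by (rule digit_sum_less) (use digit_monomial that in auto)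
    then show ?thesis by (simp add: card_field)
  qed
  then have "degree g \<le> CARD('a) - 1"
    unfolding g_def
    by (intro degree_sum_le) (auto intro!: order_trans[OF degree_monom_le])
  moreover have "CARD('a) - 1 < CARD('a)" using finite_UNIV_card_ge_0[where ?'a = 'a] by simp
  ultimately have "degree g < CARD('a)" by (rule le_less_trans)
  moreover have "poly g t = 0" for t
  proof -
    have "poly g t = poly_eval (frob_point p 1 t) N"
      unfolding g_def poly_eval_eq_sum poly_sum poly_monom code_def
      by (rule sum.cong) (simp_all add: monom_eval_frob_point[OF deg])
    then show ?thesis using zero eval_eq by simp
  qed
  ultimately have "g = 0" by (rule poly_zero_if_vanishing)
  have "Poly_Mapping.lookup N m = 0" if m: "m \<in> Poly_Mapping.keys N" for m
  proof -
    have "coeff g (code m) = (\<Sum>n\<in>Poly_Mapping.keys N. if n = m then Poly_Mapping.lookup N n else 0)"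
      unfolding g_def coeff_sum coeff_monom by (rule sum.cong) (use inj m in auto)
    then show ?thesis using \<open>g = 0\<close> m by simp
  qed
  then have "N = 0" by (intro poly_mapping_eqI) (metis in_keys_iff lookup_zero)
  then show "Q \<in> V_filt p f s 1" using N(2) by simp
qed

text \<open>
  The monomial in the \<open>y\<^sub>i\<close> alone provides the value at \<open>(0, 1)\<close>; its values at the points \<open>(1, t)\<close> are
  corrected by interpolation, with monomials that vanish at \<open>(0, 1)\<close>.
\<close>

theorem exists_with_values:
  fixes \<phi> :: "'a \<Rightarrow> 'a" and c :: 'a
  assumes s: "\<And>i. i < f \<Longrightarrow> p \<le> s i"
  shows "\<exists>Q\<in>multihom f s. poly_eval (frob_point p 0 1) Q = c \<and> (\<forall>t. poly_eval (frob_point p 1 t) Q = \<phi> t)"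
proof -
  define w where "w = (\<Sum>i<f. s i * p ^ i)"
  obtain g where g: "degree g < CARD('a)" "\<And>t. poly g t = \<phi> t - c * t ^ w"
    using interpolation[of "\<lambda>t. \<phi> t - c * t ^ w"] by blast
  define y where "y = the_monom f (\<lambda>_. 0) s"
  define d where "d n i = n div p ^ i mod p" for n i
  have d_less: "d n i < p" for n i using p_gt_1 by (simp add: d_def)
  \<comment> \<open>The monomial whose value at \<open>(1, t)\<close> is \<open>t\<^sup>n\<close>.\<close>
  define M where "M n = the_monom f (\<lambda>i. s i - d n i) (d n)" for n
  have deg_y: "has_multidegree f s y" unfolding y_def by (rule has_multidegree_the_monom) simp
  have deg_M: "has_multidegree f s (M n)" for n
    unfolding M_def
  proof (rule has_multidegree_the_monom)
    fix i assume "i < f"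
    then show "s i - d n i + d n i = s i" using s[of i] d_less[of n i] by simp
  qed
  have eval_y: "monom_eval (frob_point p u v) y = v ^ w" for u v :: 'a
    by (simp add: monom_eval_frob_point[OF deg_y]) (simp add: y_def lookup_the_monom w_def)
  define Q where "Q = Poly_Mapping.single y c + (\<Sum>n<CARD('a). Poly_Mapping.single (M n) (coeff g n))"
  have "Q \<in> multihom f s"
    unfolding Q_def by (intro multihom_add multihom_sum multihom_single deg_y deg_M)
  moreover have eval_Q: "poly_eval (frob_point p u v) Q =
      c * monom_eval (frob_point p u v) y + (\<Sum>n<CARD('a). coeff g n * monom_eval (frob_point p u v) (M n))"
    for u v
  proof -
      show ?thesis by (simp add: Q_def poly_eval.hom_add poly_eval.hom_sum poly_eval_single)
  qed
  have "poly_eval (frob_point p 0 1) Q = c"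
  proof -
    have "monom_eval (frob_point p 0 1) (M n) = (0 :: 'a)" for n
    proof -
      have "0 < (\<Sum>i<f. Poly_Mapping.lookup (M n) (XV i) * p ^ i)"
        using f_pos s[of 0] d_less[of n 0]
        by (intro sum_pos2[of _ 0]) (auto simp: M_def lookup_the_monom)
      then show ?thesis by (simp add: monom_eval_frob_point[OF deg_M])
    qed
    then show ?thesis by (simp add: eval_Q eval_y)
  qed
  moreover have "poly_eval (frob_point p 1 t) Q = \<phi> t" for t
  proof -
    have "monom_eval (frob_point p 1 t) (M n) = t ^ n" if "n < CARD('a)" for n
    proof -
      have "(\<Sum>i<f. Poly_Mapping.lookup (M n) (YV i) * p ^ i) = n"
        using sum_of_digits[of n p f] that by (simp add: card_field M_def lookup_the_monom d_def)
      then show ?thesis by (simp add: monom_eval_frob_point[OF deg_M])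
    qed
    then have "(\<Sum>n<CARD('a). coeff g n * monom_eval (frob_point p 1 t) (M n)) = (\<Sum>n<CARD('a). coeff g n * t ^ n)"
      by (intro sum.cong) auto
    also have "\<dots> = (\<Sum>n\<le>degree g. coeff g n * t ^ n)"
      using g(1) by (intro sum.mono_neutral_right) (auto simp: coeff_eq_0)
    also have "\<dots> = poly g t" by (simp add: poly_altdef)
    finally show ?thesis
      by (simp add: eval_Q g(2) eval_y)
  qed
  ultimately show ?thesis by blast
qed

end


section \<open>The action of \<open>GL\<^sub>2\<close>\<close>

lemma field_fld: "field (fld :: 'a::field ring)"
proof (rule cring.cring_fieldI)
  show "cring (fld :: 'a ring)"
    by (intro cringI abelian_groupI comm_monoidI)
      (auto simp: fld_def algebra_simps intro: exI[of _ "- _"])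
  show "Units (fld :: 'a ring) = carrier fld - {\<zero>\<^bsub>fld\<^esub>}"
  proof -
    have "\<exists>y. y * x = 1 \<and> x * y = 1" if "x \<noteq> 0" for x :: 'a
      using that by (intro exI[of _ "inverse x"]) simp
    then show ?thesis by (auto simp: fld_def Units_def)
  qed
qed

lemma group_GL2: "group (GL2 :: ('a::field ^ 2 ^ 2) monoid)"
proof (rule groupI)
  fix A :: "'a ^ 2 ^ 2" assume "A \<in> carrier GL2"
  then obtain B where "A ** B = mat 1" "B ** A = mat 1"
    by (auto simp: GL2_def invertible_def)
  then show "\<exists>B\<in>carrier GL2. B \<otimes>\<^bsub>GL2\<^esub> A = \<one>\<^bsub>GL2\<^esub>"
    by (intro bexI[of _ B]) (auto simp: GL2_def invertible_def)
qed (auto simp: GL2_def invertible_mult matrix_mul_assoc matrix_mul_lid invertible_det_nz det_mul det_I)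

lemma GL2_carrier: "A \<in> carrier GL2 \<longleftrightarrow> det A \<noteq> 0"
  by (simp add: GL2_def invertible_det_nz)

lemma matrix_mult_2:
  fixes A B :: "'a::comm_ring_1 ^ 2 ^ 2"
  shows "(A ** B) $ i $ j = A $ i $ 1 * B $ 1 $ j + A $ i $ 2 * B $ 2 $ j"
  by (simp add: matrix_matrix_mult_def sum_2)

lemma V_rep_simps [simp]:
  "carrier (V_rep p f r) = multihom f r" "zero (V_rep p f r) = 0" "add (V_rep p f r) = (+)"
  "c \<odot>\<^bsub>V_rep p f r\<^esub> P = Const c * P" "act (V_rep p f r) A = poly_subst (twisted_subst p A)"
  by (simp_all add: V_rep_def)

lemma fld_simps [simp]: "carrier fld = UNIV" "mult fld = (*)" "one fld = 1" "zero fld = 0" "add fld = (+)"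
  by (simp_all add: fld_def)

lemma GL2_simps [simp]: "mult GL2 = (**)" "one GL2 = mat 1"
  by (simp_all add: GL2_def)

lemma multihom_poly_subst:
  assumes P: "P \<in> multihom f s"
    and \<sigma>: "\<And>i. i < f \<Longrightarrow> \<sigma> (XV i) \<in> multihom f (\<lambda>k. of_bool (k = i))"
      "\<And>i. i < f \<Longrightarrow> \<sigma> (YV i) \<in> multihom f (\<lambda>k. of_bool (k = i))"
  shows "poly_subst \<sigma> P \<in> multihom f s"
  unfolding poly_subst_eq monom_ext_def
proof (intro multihom_sum multihom_Const_mult)
  fix m assume "m \<in> Poly_Mapping.keys P"
  then have m: "has_multidegree f s m" using P by (simp add: multihom_iff)
  have "monom_eval \<sigma> m \<in> multihom f (\<lambda>k. (\<Sum>i<f. Poly_Mapping.lookup m (XV i) * of_bool (k = i)) +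
      (\<Sum>i<f. Poly_Mapping.lookup m (YV i) * of_bool (k = i)))"
    unfolding monom_eval_split[OF m]
    by (intro multihom_mult multihom_prod multihom_power \<sigma>) auto
  also have "multihom f (\<lambda>k. (\<Sum>i<f. Poly_Mapping.lookup m (XV i) * of_bool (k = i)) +
      (\<Sum>i<f. Poly_Mapping.lookup m (YV i) * of_bool (k = i))) = multihom f s"
    using m by (intro multihom_cong) (auto simp: has_multidegree_def of_bool_def if_distrib cong: if_cong)
  finally show "monom_eval \<sigma> m \<in> multihom f s" .
qed

context twisted_dickson_field
begin

lemma multihom_act:
  assumes "P \<in> multihom f s"
  shows "poly_subst (twisted_subst p A) P \<in> multihom f s"
  using assms
  by (rule multihom_poly_subst)
    (auto simp: twisted_subst_def intro!: multihom_add multihom_Const_mult multihom_Var)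

lemma act_mult:
  "poly_subst (twisted_subst p A) (poly_subst (twisted_subst p B) P) =
    poly_subst (twisted_subst p (A ** B)) (P :: 'a mpoly)"
proof -
  have "poly_subst (twisted_subst p A) (twisted_subst p B v) = twisted_subst p (A ** B) v" for v
    by (cases v)
      (simp_all add: twisted_subst_def poly_subst.hom_add poly_subst.hom_mult poly_subst_Const poly_subst_Var
        matrix_mult_2 frob_add power_mult_distrib Const.hom_add Const.hom_mult algebra_simps)
  then show ?thesis by (simp add: poly_subst_poly_subst)
qed

lemma poly_eval_act:
  "poly_eval (frob_point p x y) (poly_subst (twisted_subst p A) (P :: 'a mpoly)) =
    poly_eval (frob_point p (x * A $ 1 $ 1 + y * A $ 2 $ 1) (x * A $ 1 $ 2 + y * A $ 2 $ 2)) P"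
proof -
  have "poly_eval (frob_point p x y) (twisted_subst p A v) =
      frob_point p (x * A $ 1 $ 1 + y * A $ 2 $ 1) (x * A $ 1 $ 2 + y * A $ 2 $ 2) v" for v
    by (cases v)
      (simp_all add: twisted_subst_def poly_eval.hom_add poly_eval.hom_mult poly_eval_Const poly_eval_Var
        frob_point_def frob_add power_mult_distrib mult.commute)
  then show ?thesis by (simp add: poly_eval_poly_subst)
qed

text \<open>
  By the Frobenius, \<open>(x\<^sub>i, y\<^sub>i)\<close> and \<open>(x\<^sub>i\<^sub>-\<^sub>1\<^sup>p, y\<^sub>i\<^sub>-\<^sub>1\<^sup>p)\<close> are transformed by the same matrix, and \<open>\<theta>\<^sub>i\<close> is
  the determinant of these two rows.
\<close>

lemma act_dickson:
  assumes "i < f"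
  shows "poly_subst (twisted_subst p A) (dickson p f i) = Const (det A ^ p ^ i) * (dickson p f i :: 'a mpoly)"
proof -
  have pw: "(Const (b ^ p ^ prv i) * X + Const (d ^ p ^ prv i) * Y) ^ p =
      Const (b ^ p ^ i) * X ^ p + Const (d ^ p ^ i) * (Y ^ p :: 'a mpoly)" for b d X Y
    using assms by (simp add: mpoly_power_p_add power_mult_distrib frob_prv flip: Const.hom_power)
  show ?thesis
    by (simp add: dickson_eq poly_subst.hom_minus poly_subst.hom_mult poly_subst.hom_power poly_subst_Var
      twisted_subst_def pw det_2 frob_diff power_mult_distrib Const.hom_minus Const.hom_mult)
      (simp add: algebra_simps)
qed

lemma act_theta:
  "poly_subst (twisted_subst p A) (theta j) =
    Const (det A ^ (\<Sum>i<f. j i * p ^ i)) * (theta j :: 'a mpoly)"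
proof -
  have "poly_subst (twisted_subst p A) (theta j) =
      (\<Prod>i<f. Const (det A ^ (j i * p ^ i)) * (dickson p f i ^ j i :: 'a mpoly))"
    unfolding theta_def poly_subst.hom_prod
  proof (rule prod.cong)
    fix i assume "i \<in> {..<f}"
    then show "poly_subst (twisted_subst p A) (dickson p f i ^ j i) =
        Const (det A ^ (j i * p ^ i)) * (dickson p f i ^ j i :: 'a mpoly)"
      by (simp add: poly_subst.hom_power act_dickson power_mult_distrib mult.commute[of "j i"] power_mult
        flip: Const.hom_power)
  qed simp
  then show ?thesis by (simp add: prod.distrib theta_def power_sum Const.hom_prod)
qed

lemma representation_V_rep:
  "representation fld GL2 (V_rep p f r :: ('a, 'a ^ 2 ^ 2, 'a mpoly) rep)"
proof -
  have "abelian_group (V_rep p f r :: ('a, 'a ^ 2 ^ 2, 'a mpoly) rep)"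
  proof (rule abelian_groupI)
    fix P :: "'a mpoly" assume P: "P \<in> carrier (V_rep p f r :: ('a, 'a ^ 2 ^ 2, 'a mpoly) rep)"
    show "\<exists>Q\<in>carrier (V_rep p f r :: ('a, 'a ^ 2 ^ 2, 'a mpoly) rep). Q \<oplus>\<^bsub>(V_rep p f r :: ('a, 'a ^ 2 ^ 2, 'a mpoly) rep)\<^esub> P = \<zero>\<^bsub>(V_rep p f r :: ('a, 'a ^ 2 ^ 2, 'a mpoly) rep)\<^esub>"
      using P multihom_minus[OF multihom_zero, of P f r] by (intro bexI[of _ "- P"]) auto
  qed (auto simp: multihom_add multihom_zero add_ac)
  then have "module fld (V_rep p f r :: ('a, 'a ^ 2 ^ 2, 'a mpoly) rep)"
    using domain.axioms(1)[OF field.axioms(1)[OF field_fld]]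
    by (intro moduleI)
      (auto simp: multihom_Const_mult Const.hom_add Const.hom_mult Const.hom_one distrib_left
        distrib_right mult.assoc)
  moreover have "poly_subst (twisted_subst p (mat 1)) P = (P :: 'a mpoly)" for P
  proof (rule poly_subst_ident)
    fix v show "twisted_subst p (mat 1) v = (Var v :: 'a mpoly)"
    proof -
      have z: "(0 :: 'a) ^ p ^ i = 0" for i using p_gt_1 by simp
      show ?thesis
        by (cases v) (simp_all add: twisted_subst_def mat_def Const.hom_zero Const.hom_one z)
    qed
  qed
  ultimately show ?thesis
    by (intro representation.intro representation_axioms.intro field_fld group_GL2)
      (auto simp: multihom_act act_mult poly_subst_Const
        poly_subst.hom_add
        poly_subst.hom_mult)
qed

lemma subrepresentation_theta_filt:
  assumes "downclosed D"
  shows "subrepresentation (theta_filt r D) fld GL2 (V_rep p f r :: ('a, 'a ^ 2 ^ 2, 'a mpoly) rep)"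
proof (rule representation.subrepresentationI[OF representation_V_rep])
  fix A :: "'a ^ 2 ^ 2" and P :: "'a mpoly" assume "P \<in> theta_filt r D"
  then show "act (V_rep p f r) A P \<in> theta_filt r D"
    unfolding V_rep_simps
    by (intro theta_filt_stable[OF unital_ring_hom_poly_subst poly_subst_Const act_dickson multihom_act assms])
qed (auto simp: theta_filt_zero theta_filt_add theta_filt_Const_mult dest: subsetD[OF theta_filt_subset])

subsection \<open>Principal series\<close>

text \<open>
  The factor \<open>det b\<^sup>d\<close> accounts for the action on \<open>\<theta>\<^sup>j\<close>, the other one for the homogeneity of
  the polynomials: \<open>b\<close> scales the row vector \<open>(0, 1)\<close> by its last entry.
\<close>

definition borel_char :: "nat \<Rightarrow> nat \<Rightarrow> 'a ^ 2 ^ 2 \<Rightarrow> 'a"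
  where "borel_char d w b = det b ^ d * (b $ 2 $ 2) ^ w"

definition row_eval :: "nat \<Rightarrow> 'a mpoly \<Rightarrow> 'a ^ 2 ^ 2 \<Rightarrow> 'a"
  where "row_eval d Q = (\<lambda>g\<in>carrier GL2. det g ^ d * poly_eval (frob_point p (g $ 2 $ 1) (g $ 2 $ 2)) Q)"

lemma borel_char_hom: "borel_char d w \<in> hom (GL2\<lparr>carrier := borel2\<rparr>) (units_of fld)"
proof (rule homI)
  fix b :: "'a ^ 2 ^ 2" assume "b \<in> carrier (GL2\<lparr>carrier := borel2\<rparr>)"
  then have "det b \<noteq> 0" "b $ 2 $ 2 \<noteq> 0"
    by (auto simp: borel2_def GL2_carrier det_2)
  then have "borel_char d w b \<noteq> 0" by (simp add: borel_char_def)
  then have "\<exists>y. y * borel_char d w b = 1 \<and> borel_char d w b * y = 1"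
    by (intro exI[of _ "inverse (borel_char d w b)"]) simp
  then show "borel_char d w b \<in> carrier (units_of fld)"
    by (simp add: units_of_def Units_def)
next
  fix b c :: "'a ^ 2 ^ 2"
  assume "b \<in> carrier (GL2\<lparr>carrier := borel2\<rparr>)" "c \<in> carrier (GL2\<lparr>carrier := borel2\<rparr>)"
  then show "borel_char d w (b \<otimes>\<^bsub>GL2\<lparr>carrier := borel2\<rparr>\<^esub> c) =
      borel_char d w b \<otimes>\<^bsub>units_of fld\<^esub> borel_char d w c"
    by (simp add: borel_char_def borel2_def units_of_def det_mul matrix_mult_2 power_mult_distrib)
qed

lemma row_eval_mem:
  assumes "Q \<in> multihom f s"
  shows "row_eval d Q \<in> carrier (ind_rep fld GL2 borel2 (borel_char d (\<Sum>i<f. s i * p ^ i)))"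
proof -
  have "row_eval d Q (b ** g) = borel_char d (\<Sum>i<f. s i * p ^ i) b * row_eval d Q g"
    if "b \<in> borel2" "g \<in> carrier GL2" for b g
    using that poly_eval_homogeneous[OF assms, of p "b $ 2 $ 2" "g $ 2 $ 1" "g $ 2 $ 2"]
    by (simp add: row_eval_def borel2_def GL2_carrier det_mul matrix_mult_2 borel_char_def power_mult_distrib)
  then show ?thesis by (simp add: ind_rep_def row_eval_def)
qed

text \<open>
  Together with the identity these matrices represent the cosets of the upper triangular matrices:
  their second rows \<open>(1, t)\<close> and \<open>(0, 1)\<close> are the points of the projective line.  As the determinant
  is 1, the factor \<open>det g\<^sup>d\<close> of \<open>row_eval\<close> is trivial on them.
\<close>

definition transversal :: "'a \<Rightarrow> 'a ^ 2 ^ 2"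
  where "transversal t = vector [vector [0, - 1], vector [1, t]]"

lemma transversal_simps:
  "transversal t $ 1 $ 1 = 0" "transversal t $ 1 $ 2 = - 1" "transversal t $ 2 $ 1 = 1"
  "transversal t $ 2 $ 2 = t" "det (transversal t) = 1" "transversal t \<in> carrier GL2"
  by (simp_all add: transversal_def det_2 GL2_carrier)

lemma borel_decomposition:
  assumes g: "g \<in> carrier GL2" and "g $ 2 $ 1 \<noteq> 0"
  shows "\<exists>b\<in>borel2. g = b ** transversal (g $ 2 $ 2 / g $ 2 $ 1)"
proof
  let ?t = "g $ 2 $ 2 / g $ 2 $ 1"
  define b :: "'a ^ 2 ^ 2" where
    "b = vector [vector [g $ 1 $ 1 * ?t - g $ 1 $ 2, g $ 1 $ 1], vector [0, g $ 2 $ 1]]"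
  show eq: "g = b ** transversal ?t"
    using assms(2) by (simp add: vec_eq_iff forall_2 matrix_mult_2 transversal_simps b_def)
  then have "det g = det b" by (metis det_mul transversal_simps(5) mult.right_neutral)
  then show "b \<in> borel2" using g by (simp add: borel2_def GL2_carrier) (simp add: b_def)
qed

lemma ind_rep_eqI:
  assumes \<phi>: "\<phi> \<in> carrier (ind_rep fld GL2 borel2 \<eta>)" and \<psi>: "\<psi> \<in> carrier (ind_rep fld GL2 borel2 \<eta>)"
    and one: "\<phi> (mat 1) = \<psi> (mat 1)" and tr: "\<And>t. \<phi> (transversal t) = \<psi> (transversal t)"
  shows "\<phi> = \<psi>"
proof
  fix g :: "'a ^ 2 ^ 2"
  have equi: "\<xi> (b ** g) = \<eta> b * \<xi> g"
    if "b \<in> borel2" "g \<in> carrier GL2" "\<xi> \<in> carrier (ind_rep fld GL2 borel2 \<eta>)" for b g \<xi>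
    using that by (simp add: ind_rep_def)
  show "\<phi> g = \<psi> g"
  proof (cases "g \<in> carrier GL2")
    case True
    show ?thesis
    proof (cases "g $ 2 $ 1 = 0")
      case zero: True
      have "mat 1 \<in> carrier (GL2 :: ('a ^ 2 ^ 2) monoid)" by (simp add: GL2_carrier)
      moreover have "g \<in> borel2" using True zero by (simp add: borel2_def)
      ultimately show ?thesis using equi[of g "mat 1" \<phi>] equi[of g "mat 1" \<psi>] \<phi> \<psi> one
        by (simp add: matrix_mul_rid)
    next
      case False
      then obtain b where "b \<in> borel2" "g = b ** transversal (g $ 2 $ 2 / g $ 2 $ 1)"
        using borel_decomposition[OF True] by blast
      then show ?thesis using equi[of b "transversal (g $ 2 $ 2 / g $ 2 $ 1)"] \<phi> \<psi> tr
        by (metis transversal_simps(6))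
    qed
  next
    case False
    then show ?thesis using \<phi> \<psi> by (auto simp: ind_rep_def PiE_iff extensional_def)
  qed
qed

lemma row_eval_one: "row_eval d Q (mat 1) = poly_eval (frob_point p 0 1) Q"
  by (simp add: row_eval_def GL2_carrier det_I) (simp add: mat_def)

lemma row_eval_transversal: "row_eval d Q (transversal t) = poly_eval (frob_point p 1 t) Q"
  by (simp add: row_eval_def transversal_simps)

lemma row_eval_eq_iff:
  assumes Q: "Q \<in> multihom f s" and R: "R \<in> multihom f s" and s: "\<And>i. i < f \<Longrightarrow> p \<le> s i"
  shows "row_eval d Q = row_eval d R \<longleftrightarrow> Q - R \<in> V_filt p f s 1"
proof -
  have minus: "poly_eval (frob_point p x y) (Q - R) = 0 \<longleftrightarrow>
      poly_eval (frob_point p x y) Q = poly_eval (frob_point p x y) R" for x y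
    by (simp add: poly_eval.hom_minus)
  have "row_eval d Q = row_eval d R \<longleftrightarrow>
      row_eval d Q (mat 1) = row_eval d R (mat 1) \<and>
      (\<forall>t. row_eval d Q (transversal t) = row_eval d R (transversal t))"
    using ind_rep_eqI[OF row_eval_mem[OF Q] row_eval_mem[OF R]] by metis
  also have "\<dots> \<longleftrightarrow> poly_eval (frob_point p 0 1) (Q - R) = 0 \<and>
      (\<forall>t. poly_eval (frob_point p 1 t) (Q - R) = 0)"
    by (simp add: row_eval_one row_eval_transversal minus)
  also have "\<dots> \<longleftrightarrow> Q - R \<in> V_filt p f s 1"
    using mem_V_filt_one_iff[OF multihom_minus[OF Q R]] s by blast
  finally show ?thesis .
qed

lemma row_eval_surj:
  assumes s: "\<And>i. i < f \<Longrightarrow> p \<le> s i"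
    and \<phi>: "\<phi> \<in> carrier (ind_rep fld GL2 borel2 (borel_char d (\<Sum>i<f. s i * p ^ i)))"
  shows "\<exists>Q\<in>multihom f s. row_eval d Q = \<phi>"
proof -
  obtain Q where Q: "Q \<in> multihom f s" "poly_eval (frob_point p 0 1) Q = \<phi> (mat 1)"
    "\<And>t. poly_eval (frob_point p 1 t) Q = \<phi> (transversal t)"
    using exists_with_values[where s = s and c = "\<phi> (mat 1)" and \<phi> = "\<lambda>t. \<phi> (transversal t)", OF s]
    by metis
  have "row_eval d Q = \<phi>"
    by (rule ind_rep_eqI[OF row_eval_mem[OF Q(1)] \<phi>]) (simp_all add: row_eval_one row_eval_transversal Q)
  then show ?thesis using Q(1) by blast
qed

lemma row_eval_add: "row_eval d (Q + R) = row_eval d Q \<oplus>\<^bsub>ind_rep fld GL2 borel2 \<eta>\<^esub> row_eval d R"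
  by (rule ext) (simp add: row_eval_def ind_rep_def distrib_left
    poly_eval.hom_add)

lemma row_eval_smult: "row_eval d (Const c * Q) = c \<odot>\<^bsub>ind_rep fld GL2 borel2 \<eta>\<^esub> row_eval d Q"
  by (rule ext) (simp add: row_eval_def ind_rep_def poly_eval_Const
    poly_eval.hom_mult)

lemma row_eval_act:
  assumes "h \<in> carrier GL2"
  shows "row_eval d (Const (det h ^ d) * poly_subst (twisted_subst p h) Q) =
    act (ind_rep fld GL2 borel2 \<eta>) h (row_eval d Q)"
proof (rule ext)
  fix g :: "'a ^ 2 ^ 2"
  show "row_eval d (Const (det h ^ d) * poly_subst (twisted_subst p h) Q) g =
    act (ind_rep fld GL2 borel2 \<eta>) h (row_eval d Q) g"
    using assms
    by (simp add: row_eval_def ind_rep_def poly_eval_Const poly_eval_act matrix_mult_2 det_mul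
      GL2_carrier power_mult_distrib poly_eval.hom_mult)
qed

lemma sub_rep_minus:
  fixes W :: "('a, 'a ^ 2 ^ 2, 'a mpoly) rep"
  assumes "representation fld GL2 W" "add W = (+)" "zero W = 0" "x \<in> carrier W" "y \<in> carrier W"
  shows "x \<ominus>\<^bsub>W\<^esub> y = x - y"
proof -
  interpret W: representation fld GL2 W by fact
  have "\<ominus>\<^bsub>W\<^esub> y + y = 0" using W.M.l_neg[OF assms(5)] by (simp add: assms)
  then have "\<ominus>\<^bsub>W\<^esub> y = - y" by (simp add: eq_neg_iff_add_eq_0)
  then show ?thesis by (simp add: a_minus_def assms)
qed

text \<open>
  Both the sub-quotient and the induced representation are covered by \<open>V\<^sub>s\<close>: the former through
  multiplication by \<open>\<theta>\<^sup>j\<close>, the latter through evaluation.  In both cases two elements have the same image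
  if and only if their difference lies in \<open>V\<^sub>s\<^sup>(\<^sup>1\<^sup>)\<close>.  The group acts on \<open>V\<^sub>s\<close> with an additional
  factor \<open>det h\<^sup>d\<close>, the one that \<open>\<theta>\<^sup>j\<close> picks up.
\<close>

lemma principal_series_step:
  fixes r :: "nat \<Rightarrow> nat"
  defines "V \<equiv> (V_rep p f r :: ('a, 'a ^ 2 ^ 2, 'a mpoly) rep)"
  assumes down: "downclosed D\<^sub>0" "downclosed D" "downclosed (D - {j})" "downclosed D'"
    and sub: "D \<subseteq> D\<^sub>0" "D' \<subseteq> D - {j}" and jD: "j \<in> D"
    and r: "\<And>k. k < f \<Longrightarrow> theta_degree j k + p \<le> r k"
  shows "\<exists>\<eta> \<in> hom (GL2\<lparr>carrier := borel2\<rparr>) (units_of fld). rep_isomorphic fld GL2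
    (quot_rep (sub_rep (quot_rep (sub_rep V (theta_filt r D')) (theta_filt r D\<^sub>0))
        ((\<lambda>x. theta_filt r D\<^sub>0 +>\<^bsub>sub_rep V (theta_filt r D')\<^esub> x) ` theta_filt r (D - {j})))
      ((\<lambda>x. theta_filt r D\<^sub>0 +>\<^bsub>sub_rep V (theta_filt r D')\<^esub> x) ` theta_filt r D))
    (ind_rep fld GL2 borel2 \<eta>)"
proof -
  define W where "W = sub_rep V (theta_filt r D')"
  define s where "s k = r k - theta_degree j k" for k
  define d where "d = (\<Sum>i<f. j i * p ^ i)"
  define \<eta> where "\<eta> = borel_char d (\<Sum>i<f. s i * p ^ i)"
  have s: "p \<le> s k" "r k = theta_degree j k + s k" if "k < f" for k
    using r[OF that] by (auto simp: s_def)
  have j_ext: "j \<in> extensional {..<f}" using down(2) jD by (auto simp: downclosed_def)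
  then have j_notin: "restrict j {..<f} \<notin> D - {j}" by (simp add: extensional_restrict)
  interpret V: representation fld GL2 V unfolding V_def by (rule representation_V_rep)
  have subV: "subrepresentation (theta_filt r E) fld GL2 V" if "downclosed E" for E
    unfolding V_def by (rule subrepresentation_theta_filt[OF that])
  interpret W: representation fld GL2 W
    unfolding W_def by (rule representation_sub_rep[OF V.representation_axioms subV[OF down(4)]])
  have subW: "subrepresentation (theta_filt r E) fld GL2 W" if "downclosed E" "D' \<subseteq> E" for E
    unfolding W_def
    by (intro V.subrepresentation_sub_rep subV theta_filt_antimono that down)
  have W_simps: "carrier W = theta_filt r D'" "add W = (+)" "zero W = 0"
    "c \<odot>\<^bsub>W\<^esub> P = Const c * P" "act W A = poly_subst (twisted_subst p A)" for c P A
    by (simp_all add: W_def V_def)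
  have mem: "theta j * Q \<in> theta_filt r (D - {j})" if "Q \<in> multihom f s" for Q :: "'a mpoly"
    using theta_mult_mem[OF down(3) j_notin that s(2)] .
  have memW: "P \<in> carrier W" if "P \<in> theta_filt r (D - {j})" for P :: "'a mpoly"
    using theta_filt_antimono[OF sub(2)] that by (auto simp: W_simps)
  note minus = sub_rep_minus[OF W.representation_axioms W_simps(2,3)]
  have "rep_isomorphic fld GL2
    (quot_rep (sub_rep (quot_rep W (theta_filt r D\<^sub>0))
        ((\<lambda>x. theta_filt r D\<^sub>0 +>\<^bsub>W\<^esub> x) ` theta_filt r (D - {j})))
      ((\<lambda>x. theta_filt r D\<^sub>0 +>\<^bsub>W\<^esub> x) ` theta_filt r D)) (ind_rep fld GL2 borel2 \<eta>)"
  proof (rule W.rep_isomorphic_subquotient[where X = "multihom f s" and a = "\<lambda>Q. theta j * Q" and b = "row_eval d"])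
    show "subrepresentation (theta_filt r D\<^sub>0) fld GL2 W" "subrepresentation (theta_filt r D) fld GL2 W"
      "subrepresentation (theta_filt r (D - {j})) fld GL2 W"
      using sub by (auto intro!: subW down)
    show "theta_filt r D\<^sub>0 \<subseteq> (theta_filt r D :: 'a mpoly set)"
      "theta_filt r D \<subseteq> (theta_filt r (D - {j}) :: 'a mpoly set)"
      using sub by (auto intro!: theta_filt_antimono)
    show "(\<lambda>Q. theta j * Q) ` multihom f s \<subseteq> (theta_filt r (D - {j}) :: 'a mpoly set)"
      using mem by auto
    show "row_eval d ` multihom f s = carrier (ind_rep fld GL2 borel2 \<eta>)"
      unfolding \<eta>_def using row_eval_mem row_eval_surj[where s = s, OF s(1)] by blast
  next
    fix P :: "'a mpoly" assume P: "P \<in> theta_filt r (D - {j})"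
    obtain Q where "Q \<in> multihom f s" "P - theta j * Q \<in> theta_filt r D"
      using theta_filt_cover[OF P s(2)] by blast
    then show "\<exists>Q\<in>multihom f s. P \<ominus>\<^bsub>W\<^esub> theta j * Q \<in> theta_filt r D"
      using minus[OF memW[OF P] memW[OF mem]] by auto
  next
    fix x y :: "'a mpoly" assume xy: "x \<in> multihom f s" "y \<in> multihom f s"
    have "theta j * x \<ominus>\<^bsub>W\<^esub> theta j * y = theta j * (x - y)"
      using minus[OF memW[OF mem[OF xy(1)]] memW[OF mem[OF xy(2)]]] by (simp add: right_diff_distrib)
    then show "theta j * x \<ominus>\<^bsub>W\<^esub> theta j * y \<in> theta_filt r D \<longleftrightarrow> row_eval d x = row_eval d y"
      using theta_mult_mem_iff[OF down(3) jD j_ext multihom_minus[OF xy] s(2)] row_eval_eq_iff[OF xy, OF s(1)]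
      by simp
    show "\<exists>z\<in>multihom f s. theta j * z = theta j * x \<oplus>\<^bsub>W\<^esub> theta j * y \<and>
        row_eval d z = row_eval d x \<oplus>\<^bsub>ind_rep fld GL2 borel2 \<eta>\<^esub> row_eval d y"
      using xy by (intro bexI[of _ "x + y"]) (simp_all add: W_simps distrib_left row_eval_add multihom_add)
  next
    fix c :: 'a and x :: "'a mpoly" assume "x \<in> multihom f s"
    then show "\<exists>z\<in>multihom f s. theta j * z = c \<odot>\<^bsub>W\<^esub> (theta j * x) \<and>
        row_eval d z = c \<odot>\<^bsub>ind_rep fld GL2 borel2 \<eta>\<^esub> row_eval d x"
      by (intro bexI[of _ "Const c * x"]) (simp_all add: W_simps row_eval_smult multihom_Const_mult mult.left_commute)
  next
    fix h :: "'a ^ 2 ^ 2" and x :: "'a mpoly" assume h: "h \<in> carrier GL2" and x: "x \<in> multihom f s"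
    define z where "z = Const (det h ^ d) * poly_subst (twisted_subst p h) x"
    have "theta j * z = act W h (theta j * x)"
      unfolding W_simps z_def d_def
      by (simp add: poly_subst.hom_mult act_theta mult_ac)
    moreover have "z \<in> multihom f s" using x by (simp add: z_def multihom_Const_mult multihom_act)
    ultimately show "\<exists>z\<in>multihom f s. theta j * z = act W h (theta j * x) \<and>
        row_eval d z = act (ind_rep fld GL2 borel2 \<eta>) h (row_eval d x)"
      using row_eval_act[OF h] unfolding z_def by blast
  qed
  moreover have "\<eta> \<in> hom (GL2\<lparr>carrier := borel2\<rparr>) (units_of fld)"
    unfolding \<eta>_def by (rule borel_char_hom)
  ultimately show ?thesis unfolding W_def by blast
qed

text \<open>
  The bound on \<open>r\<close> leaves, for every tuple \<open>j\<close> that is removed, a degree of at least \<open>p\<close> in each pair of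
  variables after dividing by \<open>\<theta>\<^sup>j\<close>.
\<close>

theorem decomposable_theta_filt:
  fixes r :: "nat \<Rightarrow> nat"
  assumes down: "downclosed D" "downclosed D'" and "D' \<subseteq> D" "finite (D - D')"
    and r: "\<And>j k. j \<in> D \<Longrightarrow> k < f \<Longrightarrow> theta_degree j k + p \<le> r k"
  shows "decomposable_into_principal_series (card (D - D'))
    (quot_rep (sub_rep (V_rep p f r :: ('a, 'a ^ 2 ^ 2, 'a mpoly) rep) (theta_filt r D')) (theta_filt r D))"
proof -
  let ?N = "card (D - D')"
  let ?V = "V_rep p f r :: ('a, 'a ^ 2 ^ 2, 'a mpoly) rep"
  let ?W = "sub_rep ?V (theta_filt r D')"
  obtain E where E0: "E 0 = D" and EN: "E ?N = D'" and Ed: "\<And>i. i \<le> ?N \<Longrightarrow> downclosed (E i)"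
    and step: "\<And>i. i < ?N \<Longrightarrow> \<exists>j\<in>E i. E (Suc i) = E i - {j} \<and> j \<in> D"
    using downclosed_chain[OF down \<open>D' \<subseteq> D\<close> \<open>finite (D - D')\<close>] by blast
  interpret V: representation fld GL2 ?V by (rule representation_V_rep)
  have anti: "E l \<subseteq> E i" if "i \<le> l" "l \<le> ?N" for i l
    using that
  proof (induction l)
    case (Suc l)
    have "E (Suc l) \<subseteq> E l" using step[of l] Suc.prems by auto
    then show ?case using Suc by (cases "i = Suc l") auto
  qed simp
  have "decomposable_into_principal_series ?N (quot_rep ?W (theta_filt r (E 0)))"
  proof (rule decomposable_quot_repI[where U = "\<lambda>i. theta_filt r (E i)"])
    show "representation fld GL2 ?W"
      by (rule representation_sub_rep[OF V.representation_axioms subrepresentation_theta_filt[OF down(2)]])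
    show "subrepresentation (theta_filt r (E i)) fld GL2 ?W" if "i \<le> ?N" for i
      using anti[OF that] that EN
      by (intro V.subrepresentation_sub_rep subrepresentation_theta_filt Ed down theta_filt_antimono) auto
    show "theta_filt r (E ?N) = carrier ?W" by (simp add: EN)
    show "theta_filt r (E i) \<subseteq> (theta_filt r (E (Suc i)) :: 'a mpoly set)" if "i < ?N" for i
      using anti[of i "Suc i"] that by (intro theta_filt_antimono) auto
    fix i assume i: "i < ?N"
    obtain j where j: "j \<in> E i" "E (Suc i) = E i - {j}" "j \<in> D" using step[OF i] by blast
    show "\<exists>\<eta>\<in>hom (GL2\<lparr>carrier := borel2\<rparr>) (units_of fld). rep_isomorphic fld GL2
        (quot_rep (sub_rep (quot_rep ?W (theta_filt r (E 0)))
            ((\<lambda>x. theta_filt r (E 0) +>\<^bsub>?W\<^esub> x) ` theta_filt r (E (Suc i))))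
          ((\<lambda>x. theta_filt r (E 0) +>\<^bsub>?W\<^esub> x) ` theta_filt r (E i)))
        (ind_rep fld GL2 borel2 \<eta>)"
      unfolding j(2)
    proof (rule principal_series_step)
      show "downclosed (E 0)" "downclosed (E i)" "downclosed D'" using i Ed down by auto
      show "downclosed (E i - {j})" using Ed[of "Suc i"] i j by simp
      show "E i \<subseteq> E 0" using anti[of 0 i] i by simp
      show "D' \<subseteq> E i - {j}" using anti[of "Suc i" ?N] i EN j(2) by simp
    qed (use j r in auto)
  qed
  then show ?thesis by (simp add: E0)
qed

end

theorem corollary3p5:
  fixes p f m :: nat and r :: "nat \<Rightarrow> nat"
  assumes "prime p" and "f \<ge> 1" and "CARD('a::{field,finite}) = p ^ f"
    and "\<And>i. i < f \<Longrightarrow> r i \<ge> m + m * p ^ f + p ^ f"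
  shows "decomposable_into_principal_series ((m + 1) ^ f - m ^ f)
      (quot_rep (sub_rep (V_rep p f r :: ('a, 'a ^ 2 ^ 2, 'a mpoly) rep) (V_filt p f r m))
        (V_filt p f r (m + 1)))
    \<and> decomposable_into_principal_series ((m + 1) ^ f)
      (quot_rep (V_rep p f r :: ('a, 'a ^ 2 ^ 2, 'a mpoly) rep) (V_filt p f r (m + 1)))"
proof -
  interpret twisted_dickson_field p f "TYPE('a)"
    using assms(1-3) prime_gt_1_nat by unfold_locales auto
  define B where "B k = {..<f} \<rightarrow>\<^sub>E {..<k::nat}" for k
  have B: "finite (B k)" "card (B k) = k ^ f" "downclosed (B k)" for k
    using downclosed_box by (auto simp: B_def card_PiE intro: finite_PiE)
  have filt: "V_filt p f r k = (theta_filt r (B k) :: 'a mpoly set)" for k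
    by (simp add: V_filt_eq B_def)
  have mono: "B m \<subseteq> B (m + 1)" unfolding B_def by (intro PiE_mono) auto
  have bound: "theta_degree j k + p \<le> r k" if "j \<in> B (m + 1)" "k < f" for j k
  proof -
    have "p ^ 1 \<le> p ^ f" using assms(2) p_gt_1 by (intro power_increasing) auto
    then have "p * m \<le> m * p ^ f" "p \<le> p ^ f" by simp_all
    moreover have "theta_degree j k \<le> m + p * m"
      using that by (intro theta_degree_le) (auto simp: B_def PiE_iff less_Suc_eq_le)
    ultimately show ?thesis using assms(4)[OF that(2)] by linarith
  qed
  have "card (B (m + 1) - B m) = (m + 1) ^ f - m ^ f"
    using mono B by (simp add: card_Diff_subset)
  then have "decomposable_into_principal_series ((m + 1) ^ f - m ^ f)
      (quot_rep (sub_rep (V_rep p f r :: ('a, 'a ^ 2 ^ 2, 'a mpoly) rep) (V_filt p f r m))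
        (V_filt p f r (m + 1)))"
    unfolding filt using decomposable_theta_filt[OF B(3) B(3) mono _ bound] B(1) by simp
  moreover have "downclosed {}" by (simp add: downclosed_def)
  then have "decomposable_into_principal_series (card (B (m + 1) - {}))
      (quot_rep (sub_rep (V_rep p f r :: ('a, 'a ^ 2 ^ 2, 'a mpoly) rep) (theta_filt r {}))
        (theta_filt r (B (m + 1))))"
    using B bound by (intro decomposable_theta_filt) auto
  then have "decomposable_into_principal_series ((m + 1) ^ f)
      (quot_rep (V_rep p f r :: ('a, 'a ^ 2 ^ 2, 'a mpoly) rep) (V_filt p f r (m + 1)))"
    unfolding filt theta_filt_empty by (simp add: B V_rep_def)
  ultimately show ?thesis by blast
qed

end
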